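(* Consider the opportunistic beamforming network described in the context, with a general path loss model $G$: a function of the distance $d$ that is continuous, positive and non-increasing, with $G(d)=O(d^{-\alpha})$ as $d\to\infty$ for some $\alpha>2$. For a given communication rate $x\ge 0$, the beam outage probability $F_r(x)$ is equal to $F^\star_\gamma(e^x-1)$, where, for $x\ge 0$, $$F^\star_\gamma(x)=\exp\left(\frac{-\lambda\pi}{(x+1)^{M-1}}\int_0^{D^2}\exp\left(\frac{-x}{G(\sqrt t)\,\rho}\right)dt\right).$$
   Context: Network model. The cell is the disk of radius $D>0$ in the plane with the base station (BS) at its center. Mobile users (MUs) are distributed over the plane according to a homogeneous Poisson point process of intensity $\lambda>0$. Let $N$ be the (random) number of MUs in the cell, so $N$ is Poisson with mean $\lambda\pi D^2$; given $N$, the MU locations in the cell are i.i.d. uniform on the disk. The BS has $M\ge 1$ antennas, each MU has a single antenna, and the BS uses $M$ orthonormal beamforming vectors $\boldsymbol b_1,\dots,\boldsymbol b_M\in\mathbb C^M$ (generated independently of everything else), with transmit power $\rho>0$ per beam. The fading vector $\boldsymbol h_i\in\mathbb C^M$ of MU $i$ has i.i.d. entries drawn from the zero-mean unit-variance circularly-symmetric complex Gaussian distribution $\mathcal{CN}(0,1)$; fading vectors are independent across MUs and independent of the MU locations. The path loss coefficient of MU $i$ is $g_i=G(d_i)$, where $d_i$ is its distance from the BS. $G$ may be unbounded near $d=0$ (e.g. $G(d)=d^{-\alpha}$), in which case it is regarded as a function on $(0,\infty)$. SINR. The signal-to-interference-plus-noise ratio of beam $m$ at MU $i$ is $$\gamma_{m,i}=\frac{|\boldsymbol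 h_i^\top\boldsymbol b_m|^2}{(\rho g_i)^{-1}+\sum_{k\ne m}|\boldsymbol h_i^\top\boldsymbol b_k|^2}.$$ Rate and outage. The BS schedules on each beam the MU in the cell with the highest SINR on that beam; the rate on beam $m$ is $r_m=\log\left(1+\max_i\gamma_{m,i}\right)$, the maximum being over the $N$ MUs in the cell and taken to be $0$ if $N=0$. $F^\star_\gamma$ denotes the cumulative distribution function of $\max_i\gamma_{m,i}$ (it does not depend on $m$). The beam outage probability at target rate $x$ is $F_r(x)=\Pr\{r_m\le x\}$. *)

theory Defs
  imports "HOL-Probability.Probability" "HOL-Library.Landau_Symbols"
begin

text \<open>
  A point process on a Euclidean space is given by a measurable enumeration \<open>X 0, X 1, \<dots>\<close> of its
  points; a homogeneous Poisson process of positive intensity on the whole space almost surely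
  has infinitely many points, so no point has to be left out. Almost sure local finiteness is
  required separately because \<^const>\<open>card\<close> is 0 on infinite sets. The Poisson weights are written
  out because they are also needed for sets of measure 0 (rate 0).
\<close>

definition point_count :: "(nat \<Rightarrow> 'w \<Rightarrow> 'a) \<Rightarrow> 'a set \<Rightarrow> 'w \<Rightarrow> nat" where
  "point_count X A \<omega> = card {i. X i \<omega> \<in> A}"

definition (in prob_space) homogeneous_ppp ::
    "real \<Rightarrow> (nat \<Rightarrow> 'a \<Rightarrow> 'b::euclidean_space) \<Rightarrow> bool" where
  "homogeneous_ppp lam X \<longleftrightarrow>
    (\<forall>i. random_variable borel (X i)) \<and>
    (\<forall>A\<in>sets borel. bounded A \<longrightarrow>
       (AE \<omega> in M. finite {i. X i \<omega> \<in> A}) \<and>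
       (\<forall>k. \<P>(\<omega> in M. point_count X A \<omega> = k) =
              (lam * measure lborel A) ^ k / fact k * exp (- (lam * measure lborel A)))) \<and>
    (\<forall>\<A>. finite \<A> \<longrightarrow> disjoint \<A> \<longrightarrow> (\<forall>A\<in>\<A>. A \<in> sets borel \<and> bounded A) \<longrightarrow>
       indep_vars (\<lambda>_. count_space UNIV) (\<lambda>A. point_count X A) \<A>)"

text \<open>
  Independence of two random variables with values in possibly different types;
  \<^const>\<open>prob_space.indep_var\<close> needs equal value types.
\<close>

definition (in prob_space) indep_rv ::
    "'b measure \<Rightarrow> ('a \<Rightarrow> 'b) \<Rightarrow> 'c measure \<Rightarrow> ('a \<Rightarrow> 'c) \<Rightarrow> bool" where
  "indep_rv S X T Y \<longleftrightarrow> random_variable S X \<and> random_variable T Y \<and>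
    indep_set {X -` A \<inter> space M | A. A \<in> sets S} {Y -` B \<inter> space M | B. B \<in> sets T}"

text \<open>
  The law \<open>CN(0,1)\<close>: real and imaginary part are independent centred normal variables of
  variance 1/2 each. The second argument of \<^const>\<open>normal_density\<close> is the standard deviation.
\<close>

definition std_complex_normal :: "complex measure" where
  "std_complex_normal =
     distr (density lborel (normal_density 0 (sqrt (1/2))) \<Otimes>\<^sub>M
            density lborel (normal_density 0 (sqrt (1/2))))
       borel (\<lambda>(x, y). Complex x y)"

definition orthonormal_beams :: "('m::finite \<Rightarrow> complex ^ 'm) \<Rightarrow> bool" where
  "orthonormal_beams b \<longleftrightarrow>
    (\<forall>k l. (\<Sum>j\<in>UNIV. b k $ j * cnj (b l $ j)) = (if k = l then 1 else 0))"

text \<open>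
  \<open>|h\<^sup>T b|\<^sup>2\<close>, with the bilinear product (no conjugation).
\<close>

definition beam_gain :: "complex ^ 'm::finite \<Rightarrow> complex ^ 'm \<Rightarrow> real" where
  "beam_gain h b = (cmod (\<Sum>j\<in>UNIV. h $ j * b $ j))\<^sup>2"

definition sinr :: "real \<Rightarrow> real \<Rightarrow> complex ^ 'm::finite \<Rightarrow> ('m \<Rightarrow> complex ^ 'm) \<Rightarrow> 'm \<Rightarrow> real" where
  "sinr \<rho> g h b m = beam_gain h (b m) / (inverse (\<rho> * g) + (\<Sum>k\<in>UNIV - {m}. beam_gain h (b k)))"

text \<open>
  The network: \<open>loc i\<close> and \<open>h i\<close> are the location and the fading vector of mobile user \<open>i\<close>, and
  \<open>b m\<close> is the \<open>m\<close>-th beamforming vector. Antennas and beams are both indexed by the type \<open>'m\<close>,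
  so that the number of antennas is \<open>CARD('m)\<close>. The base station is at the origin.
\<close>

locale beamforming_network = prob_space P for P :: "'w measure" +
  fixes lam :: real
    and loc :: "nat \<Rightarrow> 'w \<Rightarrow> real ^ 2"
    and h :: "nat \<Rightarrow> 'w \<Rightarrow> complex ^ 'm::finite"
    and b :: "'m \<Rightarrow> 'w \<Rightarrow> complex ^ 'm"
  assumes locations_ppp: "homogeneous_ppp lam loc"
    and fading_law: "distr P borel (\<lambda>\<omega>. h i \<omega> $ j) = std_complex_normal"
    and fading_indep: "indep_vars (\<lambda>_. borel) (\<lambda>(i, j) \<omega>. h i \<omega> $ j) UNIV"
    and fading_locations_indep:
      "indep_rv (Pi\<^sub>M UNIV (\<lambda>_. borel)) (\<lambda>\<omega> i. h i \<omega>) (Pi\<^sub>M UNIV (\<lambda>_. borel)) (\<lambda>\<omega> i. loc i \<omega>)"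
    and beams_orthonormal: "\<omega> \<in> space P \<Longrightarrow> orthonormal_beams (\<lambda>m. b m \<omega>)"
    and beams_indep:
      "indep_rv (Pi\<^sub>M UNIV (\<lambda>_. borel)) (\<lambda>\<omega> m. b m \<omega>)
         (Pi\<^sub>M UNIV (\<lambda>_. borel) \<Otimes>\<^sub>M Pi\<^sub>M UNIV (\<lambda>_. borel)) (\<lambda>\<omega>. (\<lambda>i. h i \<omega>, \<lambda>i. loc i \<omega>))"

definition cell_users :: "real \<Rightarrow> (nat \<Rightarrow> 'w \<Rightarrow> real ^ 2) \<Rightarrow> 'w \<Rightarrow> nat set" where
  "cell_users D loc \<omega> = {i. loc i \<omega> \<in> cball 0 D}"

definition user_sinr ::
    "real \<Rightarrow> (real \<Rightarrow> real) \<Rightarrow> (nat \<Rightarrow> 'w \<Rightarrow> real ^ 2) \<Rightarrow> (nat \<Rightarrow> 'w \<Rightarrow> complex ^ 'm::finite) \<Rightarrow>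
     ('m \<Rightarrow> 'w \<Rightarrow> complex ^ 'm) \<Rightarrow> 'm \<Rightarrow> nat \<Rightarrow> 'w \<Rightarrow> real" where
  "user_sinr \<rho> G loc h b m i \<omega> = sinr \<rho> (G (dist 0 (loc i \<omega>))) (h i \<omega>) (\<lambda>k. b k \<omega>) m"

definition max_sinr ::
    "real \<Rightarrow> real \<Rightarrow> (real \<Rightarrow> real) \<Rightarrow> (nat \<Rightarrow> 'w \<Rightarrow> real ^ 2) \<Rightarrow> (nat \<Rightarrow> 'w \<Rightarrow> complex ^ 'm::finite) \<Rightarrow>
     ('m \<Rightarrow> 'w \<Rightarrow> complex ^ 'm) \<Rightarrow> 'm \<Rightarrow> 'w \<Rightarrow> real" where
  "max_sinr D \<rho> G loc h b m \<omega> =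
     (if cell_users D loc \<omega> = {} then 0
      else Max ((\<lambda>i. user_sinr \<rho> G loc h b m i \<omega>) ` cell_users D loc \<omega>))"

definition beam_rate ::
    "real \<Rightarrow> real \<Rightarrow> (real \<Rightarrow> real) \<Rightarrow> (nat \<Rightarrow> 'w \<Rightarrow> real ^ 2) \<Rightarrow> (nat \<Rightarrow> 'w \<Rightarrow> complex ^ 'm::finite) \<Rightarrow>
     ('m \<Rightarrow> 'w \<Rightarrow> complex ^ 'm) \<Rightarrow> 'm \<Rightarrow> 'w \<Rightarrow> real" where
  "beam_rate D \<rho> G loc h b m \<omega> = ln (1 + max_sinr D \<rho> G loc h b m \<omega>)"

definition max_sinr_cdf ::
    "'w measure \<Rightarrow> real \<Rightarrow> real \<Rightarrow> (real \<Rightarrow> real) \<Rightarrow> (nat \<Rightarrow> 'w \<Rightarrow> real ^ 2) \<Rightarrow> (nat \<Rightarrow> 'w \<Rightarrow> complex ^ 'm::finite) \<Rightarrow>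
     ('m \<Rightarrow> 'w \<Rightarrow> complex ^ 'm) \<Rightarrow> 'm \<Rightarrow> real \<Rightarrow> real" where
  "max_sinr_cdf P D \<rho> G loc h b m = cdf (distr P borel (max_sinr D \<rho> G loc h b m))"

definition beam_outage_prob ::
    "'w measure \<Rightarrow> real \<Rightarrow> real \<Rightarrow> (real \<Rightarrow> real) \<Rightarrow> (nat \<Rightarrow> 'w \<Rightarrow> real ^ 2) \<Rightarrow> (nat \<Rightarrow> 'w \<Rightarrow> complex ^ 'm::finite) \<Rightarrow>
     ('m \<Rightarrow> 'w \<Rightarrow> complex ^ 'm) \<Rightarrow> 'm \<Rightarrow> real \<Rightarrow> real" where
  "beam_outage_prob P D \<rho> G loc h b m r = \<P>(\<omega> in P. beam_rate D \<rho> G loc h b m \<omega> \<le> r)"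

end

theory Submission
  imports Defs
begin

text \<open>
  Condition on the beams and on the user locations. Because the standard complex Gaussian law on
  \<open>\<complex>\<^sup>M\<close> is invariant under unitary maps, the gains \<open>|h\<^sup>T b\<^sub>k|\<^sup>2\<close> of a user are i.i.d. exponential, so a user
  at distance \<open>d\<close> has \<open>Pr(\<gamma> \<le> y) = 1 - exp (- y / (\<rho> G(d))) / (1 + y)\<^bsup>M-1\<^esup>\<close>. These events are
  independent across users, hence the distribution function of the maximum is the probability
  generating functional of the Poisson process evaluated at this function of the location; a
  radial integration turns the resulting integral over the disk into one over \<open>[0, D\<^sup>2]\<close>.
\<close>

text \<open>The locations are specified through counts of bounded Borel sets, not as i.i.d. uniform
  positions given the number of users. The generating functional is therefore computed for simple
  functions, whose level sets carry independent Poisson counts, and extended by dominated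
  convergence. Unitary invariance reduces to two facts: the Gaussian density depends on the norm
  only, and linear isometries preserve \<open>lborel\<close>. Conditioning is Fubini for a product
  law; the beams are frozen outermost, and as the inner probability is the same for every
  orthonormal system, their law disappears. The exponent M - 1 counts the interfering beams, each
  contributing the Laplace transform 1 / (1 + y). Two degeneracies shape the details:
  \<open>G 0\<close> is arbitrary, so users at the origin are discarded as a null event; and
  \<open>card\<close>, \<open>prod\<close> and \<open>Max\<close> have default values on infinite
  sets, so almost sure finiteness of the cell enters repeatedly.\<close>

subsection \<open>Lebesgue measure on Euclidean spaces\<close>

text \<open>
  The double integral of \<open>1\<^sub>A(x) 1\<^sub>B(x + y)\<close> over \<open>\<mu> \<otimes> lborel\<close>, evaluated in both orders, gives
  \<open>\<mu>(A) lborel(B) = lborel(-A) \<mu>(B)\<close>; take \<open>A\<close> to be the unit ball.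
\<close>

lemma translation_invariant_measure_unique:
  fixes \<mu> :: "'a::euclidean_space measure"
  assumes [measurable_cong]: "sets \<mu> = sets borel"
    and "sigma_finite_measure \<mu>"
    and inv: "\<And>a. distr \<mu> borel (\<lambda>x. a + x) = \<mu>"
    and ball: "emeasure \<mu> (ball 0 1) = emeasure lborel (ball 0 1 :: 'a set)"
  shows "\<mu> = lborel"
proof (rule measure_eqI)
  fix B assume "B \<in> sets \<mu>"
  then have B[measurable]: "B \<in> sets borel" by (simp add: assms)
  interpret M: sigma_finite_measure \<mu> by fact
  interpret pair_sigma_finite \<mu> "lborel :: 'a measure" ..
  let ?A = "ball 0 1 :: 'a set"
  let ?c = "emeasure lborel ?A"
  have sh: "(\<integral>\<^sup>+x. f (a + x) \<partial>\<mu>) = (\<integral>\<^sup>+x. f x \<partial>\<mu>)"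
    if [measurable]: "f \<in> borel_measurable borel" for f :: "'a \<Rightarrow> ennreal" and a
    by (subst (2) inv[of a, symmetric]) (simp add: nn_integral_distr)
  have shl: "(\<integral>\<^sup>+x. f (a + x) \<partial>lborel) = (\<integral>\<^sup>+x. f x \<partial>lborel)"
    if [measurable]: "f \<in> borel_measurable borel" for f :: "'a \<Rightarrow> ennreal" and a
    by (subst (2) lborel_distr_plus[of a, symmetric]) (simp add: nn_integral_distr)
  have [measurable]: "?A \<in> sets borel" by simp
  have prod: "f \<in> borel_measurable (\<mu> \<Otimes>\<^sub>M lborel)" if "f \<in> borel_measurable (borel \<Otimes>\<^sub>M borel)"
    for f :: "'a \<times> 'a \<Rightarrow> ennreal"
    using that by (simp add: assms(1) cong: measurable_cong_sets sets_pair_measure_cong)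
  have ind: "(\<integral>\<^sup>+x. indicator S x * c \<partial>\<mu>) = emeasure \<mu> S * c"
    if "S \<in> sets borel" for S c
    using that by (subst nn_integral_multc) (auto intro: borel_measurable_indicator simp: assms(1))
  have "emeasure \<mu> ?A * emeasure lborel B =
      (\<integral>\<^sup>+x. indicator ?A x * (\<integral>\<^sup>+y. indicator B (x + y) \<partial>lborel) \<partial>\<mu>)"
    by (subst shl) (simp_all add: ind)
  also have "\<dots> = (\<integral>\<^sup>+x. \<integral>\<^sup>+y. indicator ?A x * indicator B (x + y) \<partial>lborel \<partial>\<mu>)"
    by (intro nn_integral_cong nn_integral_cmult[symmetric]) simp
  also have "\<dots> = (\<integral>\<^sup>+y. \<integral>\<^sup>+x. indicator ?A x * indicator B (x + y) \<partial>\<mu> \<partial>lborel)"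
    by (intro Fubini'[symmetric] prod) measurable
  also have "\<dots> = (\<integral>\<^sup>+y. \<integral>\<^sup>+x. indicator ?A (- y + x) * indicator B x \<partial>\<mu> \<partial>lborel)"
  proof (rule nn_integral_cong)
    fix y :: 'a
    show "(\<integral>\<^sup>+x. indicator ?A x * indicator B (x + y) \<partial>\<mu>) =
        (\<integral>\<^sup>+x. indicator ?A (- y + x) * indicator B x \<partial>\<mu>)"
      by (subst sh[of "\<lambda>x. indicator ?A (- y + x) * indicator B x" y, symmetric])
        (simp_all add: add.commute)
  qed
  also have "\<dots> = (\<integral>\<^sup>+x. \<integral>\<^sup>+y. indicator ?A (- y + x) * indicator B x \<partial>lborel \<partial>\<mu>)"
    by (intro Fubini' prod) measurable
  also have "\<dots> = (\<integral>\<^sup>+x. (\<integral>\<^sup>+y. indicator ?A (- x + y) \<partial>lborel) * indicator B x \<partial>\<mu>)"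
    by (simp add: nn_integral_multc dist_norm norm_minus_commute indicator_def)
  also have "\<dots> = ?c * emeasure \<mu> B"
    by (subst shl) (simp_all add: ind mult.commute)
  finally have "?c * emeasure \<mu> B = ?c * emeasure lborel B" using ball by simp
  moreover have "?c \<noteq> 0" "?c \<noteq> \<infinity>" by (auto simp: emeasure_ball less_imp_neq[OF unit_ball_vol_pos, symmetric])
  ultimately show "emeasure \<mu> B = emeasure lborel B"
    by (simp add: ennreal_mult_cancel_left)
qed (simp add: assms)

text \<open>The image measure gives the unit ball its usual mass because the preimage of a centred
  ball is that ball. It is translation invariant because \<open>T\<close> is onto: a shift by
  \<open>T a'\<close> after \<open>T\<close> is a shift by \<open>a'\<close> before it.\<close>

lemma distr_lborel_isometry:
  fixes T :: "'a::euclidean_space \<Rightarrow> 'a"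
  assumes "linear T" and norm: "\<And>x. norm (T x) = norm x"
  shows "distr lborel borel T = lborel"
proof (rule translation_invariant_measure_unique)
  interpret linear T by fact
  have orth: "orthogonal_transformation T"
    using assms by (simp add: orthogonal_transformation)
  have [measurable]: "T \<in> borel_measurable borel"
    by (intro borel_measurable_continuous_onI linear_continuous_on linear_linear[THEN iffD2] assms)
  have vim: "T -` ball 0 r = ball 0 r" for r
    by (auto simp: norm)
  show "emeasure (distr lborel borel T) (ball 0 1) = emeasure lborel (ball 0 1 :: 'a set)"
    by (subst emeasure_distr) (auto simp: vim)
  show "sigma_finite_measure (distr lborel borel T)"
  proof
    show "\<exists>A. countable A \<and> A \<subseteq> sets (distr lborel borel T) \<and> \<Union> A = space (distr lborel borel T) \<and>
        (\<forall>a\<in>A. emeasure (distr lborel borel T) a \<noteq> \<infinity>)"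
    proof (intro exI[of _ "(\<lambda>n. ball 0 (real n)) ` UNIV"] conjI ballI)
      show "\<Union> (range (\<lambda>n. ball 0 (real n))) = space (distr lborel borel T)"
        by (auto simp: reals_Archimedean2)
    qed (auto simp: emeasure_distr vim emeasure_ball)
  qed
  fix a
  obtain a' where a: "a = T a'"
    using orthogonal_transformation_surj[OF orth] by (metis surjD)
  have "distr (distr lborel borel T) borel (\<lambda>x. a + x) = distr lborel borel (\<lambda>x. T (a' + x))"
    by (subst distr_distr) (auto simp: comp_def a add)
  also have "\<dots> = distr (distr lborel borel (\<lambda>x. a' + x)) borel T"
    by (subst distr_distr) (auto simp: comp_def)
  also have "\<dots> = distr lborel borel T"
    by (simp add: lborel_distr_plus)
  finally show "distr (distr lborel borel T) borel (\<lambda>x. a + x) = distr lborel borel T" .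
qed simp

text \<open>The disk of radius sqrt x has area pi x, so the squared norm has constant density pi on
  the half-line. This replaces polar coordinates, both for the law of a squared Gaussian modulus and
  for the integral over the cell.\<close>

lemma distr_lborel_norm_square:
  assumes "DIM('a::euclidean_space) = 2"
  shows "distr (lborel :: 'a measure) borel (\<lambda>x. (norm x)\<^sup>2) =
    density lborel (\<lambda>t. ennreal pi * indicator {0..} t)"
proof -
  have em: "emeasure (distr (lborel :: 'a measure) borel (\<lambda>x. (norm x)\<^sup>2)) {..x} = pi * max 0 x" for x
  proof -
    have "(norm z)\<^sup>2 \<le> x \<longleftrightarrow> 0 \<le> x \<and> norm z \<le> sqrt x" for z :: 'a
      by (metis norm_ge_zero order_trans real_le_rsqrt real_sqrt_le_iff real_sqrt_abs abs_norm_cancel zero_le_power2)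
    then have "(\<lambda>z::'a. (norm z)\<^sup>2) -` {..x} = (if x < 0 then {} else cball 0 (sqrt x))"
      by auto
    then show ?thesis
      using assms by (auto simp: emeasure_distr emeasure_cball unit_ball_vol_2)
  qed
  have em2: "emeasure (density lborel (\<lambda>t. ennreal pi * indicator {0..} t)) {..x} = pi * max 0 x" for x
  proof -
    have "emeasure (density lborel (\<lambda>t. ennreal pi * indicator {0..} t)) {..x} =
        (\<integral>\<^sup>+t. ennreal pi * indicator {0..x} t \<partial>lborel)"
      by (subst emeasure_density) (auto intro!: nn_integral_cong simp: indicator_def)
    also have "\<dots> = ennreal pi * emeasure lborel {0..x}"
      by (simp add: nn_integral_cmult)
    also have "\<dots> = pi * max 0 x"
      by (simp add: emeasure_lborel_Icc_eq ennreal_mult max_def)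
    finally show ?thesis .
  qed
  have borel: "sets (borel :: real measure) = sigma_sets UNIV (range (\<lambda>x. {..x}))"
    by (subst borel_eq_atMost, rule sets_measure_of) simp
  show ?thesis
  proof (rule measure_eqI_generator_eq[where E = "range (\<lambda>x::real. {..x})" and \<Omega> = UNIV and A = "\<lambda>n. {..real n}"])
  show "Int_stable (range (\<lambda>x::real. {..x}))"
    by (auto simp: Int_stable_def)
  show "sets (distr (lborel :: 'a measure) borel (\<lambda>x. (norm x)\<^sup>2)) = sigma_sets UNIV (range (\<lambda>x. {..x}))"
    "sets (density lborel (\<lambda>t::real. ennreal pi * indicator {0..} t)) = sigma_sets UNIV (range (\<lambda>x. {..x}))"
    by (simp_all add: borel)
  show "(\<Union>n. {..real n}) = UNIV" by (auto simp: real_arch_simple)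
qed (auto simp: em2 em)
qed

text \<open>On a rectangle both measures factor into one-dimensional integrals. This lets the joint
  law of independent Gaussian coordinates be written as one density.\<close>

lemma PiM_density:
  assumes "finite I" and "\<And>i. sigma_finite_measure (M i)"
    and [measurable]: "\<And>i. f i \<in> borel_measurable (M i)"
    and "\<And>i. sigma_finite_measure (density (M i) (f i))"
  shows "PiM I (\<lambda>i. density (M i) (f i)) = density (PiM I M) (\<lambda>x. \<Prod>i\<in>I. f i (x i))"
proof (rule product_sigma_finite.PiM_eqI[symmetric])
  show "product_sigma_finite (\<lambda>i. density (M i) (f i))"
    using assms(4) by (simp add: product_sigma_finite_def)
  interpret product_sigma_finite M
    using assms(2) by (simp add: product_sigma_finite_def)
  show "finite I" by fact
  show "sets (density (PiM I M) (\<lambda>x. \<Prod>i\<in>I. f i (x i))) = sets (PiM I (\<lambda>i. density (M i) (f i)))"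
    by (simp cong: sets_PiM_cong)
  fix A assume "\<And>i. i \<in> I \<Longrightarrow> A i \<in> sets (density (M i) (f i))"
  then have A: "\<And>i. i \<in> I \<Longrightarrow> A i \<in> sets (M i)" by simp
  have "emeasure (density (PiM I M) (\<lambda>x. \<Prod>i\<in>I. f i (x i))) (Pi\<^sub>E I A) =
      (\<integral>\<^sup>+x. (\<Prod>i\<in>I. f i (x i)) * indicator (Pi\<^sub>E I A) x \<partial>PiM I M)"
    using A \<open>finite I\<close> by (intro emeasure_density sets_PiM_I_finite) measurable
  also have "\<dots> = (\<integral>\<^sup>+x. (\<Prod>i\<in>I. f i (x i) * indicator (A i) (x i)) \<partial>PiM I M)"
  proof (rule nn_integral_cong)
    fix x assume "x \<in> space (PiM I M)"
    then have "indicator (Pi\<^sub>E I A) x = (\<Prod>i\<in>I. indicator (A i) (x i) :: ennreal)"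
      using \<open>finite I\<close> by (auto simp: indicator_def space_PiM PiE_iff prod.neutral)
    then show "(\<Prod>i\<in>I. f i (x i)) * indicator (Pi\<^sub>E I A) x = (\<Prod>i\<in>I. f i (x i) * indicator (A i) (x i))"
      by (simp add: prod.distrib)
  qed
  also have "\<dots> = (\<Prod>i\<in>I. \<integral>\<^sup>+y. f i y * indicator (A i) y \<partial>M i)"
    using A by (intro product_nn_integral_prod[OF \<open>finite I\<close>] borel_measurable_times_ennreal
        borel_measurable_indicator assms(3))
  also have "\<dots> = (\<Prod>i\<in>I. emeasure (density (M i) (f i)) (A i))"
    using A by (intro prod.cong) (simp_all add: emeasure_density)
  finally show "emeasure (density (PiM I M) (\<lambda>x. \<Prod>i\<in>I. f i (x i))) (Pi\<^sub>E I A) =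
      (\<Prod>i\<in>I. emeasure (density (M i) (f i)) (A i))" .
qed

section \<open>Complex numbers and vectors: Lebesgue measure as an image of product measures\<close>

lemma borel_measurable_Complex [measurable]:
  "(\<lambda>(x, y). Complex x y) \<in> borel_measurable (borel \<Otimes>\<^sub>M borel)"
proof -
  have "(\<lambda>p. complex_of_real (fst p) + \<i> * complex_of_real (snd p)) \<in> borel_measurable (borel \<Otimes>\<^sub>M borel)"
    by measurable
  then show ?thesis
    by (simp add: Complex_eq case_prod_beta)
qed

text \<open>Links the pair of real measures behind \<open>std_complex_normal\<close> to
  \<open>lborel\<close> on the complex plane; a complex box is a product of two intervals.\<close>

lemma lborel_complex_eq:
  "(lborel :: complex measure) = distr (lborel \<Otimes>\<^sub>M lborel) borel (\<lambda>(x, y). Complex x y)"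
proof (rule lborel_eqI)
  fix l u :: complex assume lu: "\<And>b. b \<in> Basis \<Longrightarrow> l \<bullet> b \<le> u \<bullet> b"
  then have le: "Re l \<le> Re u" "Im l \<le> Im u"
    using lu[of 1] lu[of \<i>] by (simp_all add: Basis_complex_def)
  have "(\<lambda>(x, y). Complex x y) -` box l u = {Re l<..<Re u} \<times> {Im l<..<Im u}"
    by (auto simp: in_box_complex_iff)
  then show "emeasure (distr (lborel \<Otimes>\<^sub>M lborel) borel (\<lambda>(x, y). Complex x y)) (box l u) =
      ennreal (\<Prod>b\<in>Basis. (u - l) \<bullet> b)"
    using le by (simp add: emeasure_distr space_pair_measure Basis_complex_def
        lborel.emeasure_pair_measure_Times ennreal_mult)
qed simp

lemma borel_measurable_vec_lambda [measurable]:
  "(\<lambda>f. \<chi> i. (f i :: 'a::euclidean_space)) \<in> borel_measurable (PiM UNIV (\<lambda>_::'n::finite. borel))"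
  by (subst borel_measurable_euclidean_space) (auto simp: Basis_vec_def inner_axis)

lemma borel_measurable_vec_nth [measurable]:
  "(\<lambda>x. x $ i :: 'a::euclidean_space) \<in> borel_measurable (borel :: ('a ^ 'n::finite) measure)"
  by (intro borel_measurable_continuous_onI continuous_intros)

lemma lborel_vec_eq:
  "(lborel :: ('a::euclidean_space ^ 'n::finite) measure) =
    distr (PiM UNIV (\<lambda>_. lborel)) borel (\<lambda>f. \<chi> i. f i)"
proof (rule lborel_eqI)
  interpret product_sigma_finite "\<lambda>_::'n. lborel :: 'a measure"
    by standard
  fix l u :: "'a ^ 'n" assume le: "\<And>b. b \<in> Basis \<Longrightarrow> l \<bullet> b \<le> u \<bullet> b"
  then have le': "b \<in> Basis \<Longrightarrow> l $ i \<bullet> b \<le> u $ i \<bullet> b" for i b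
    using le[of "axis i b"] by (auto simp: Basis_vec_def inner_axis)
  have "(\<lambda>f. \<chi> i. f i) -` box l u = Pi\<^sub>E UNIV (\<lambda>i. box (l $ i) (u $ i))"
    by (auto simp: box_def Basis_vec_def inner_axis)
  then have "emeasure (distr (PiM UNIV (\<lambda>_. lborel)) borel (\<lambda>f. \<chi> i. f i)) (box l u) =
      (\<Prod>i\<in>UNIV. emeasure lborel (box (l $ i) (u $ i)))"
    by (simp add: emeasure_distr space_PiM emeasure_PiM)
  also have "\<dots> = ennreal (\<Prod>i\<in>UNIV. \<Prod>b\<in>Basis. (u $ i - l $ i) \<bullet> b)"
    using le' by (simp add: emeasure_lborel_box inner_diff_left prod_ennreal prod_nonneg)
  also have "(\<Prod>i\<in>UNIV. \<Prod>b\<in>Basis. (u $ i - l $ i) \<bullet> b) =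
      (\<Prod>(i, b)\<in>UNIV \<times> Basis. (u - l) \<bullet> axis i b)"
    by (simp add: prod.cartesian_product inner_axis)
  also have "\<dots> = (\<Prod>b\<in>Basis. (u - l) \<bullet> b)"
  \<comment> \<open>The basis of the vector space consists of the vectors \<open>axis i b\<close>,
    so the double product over coordinates and basis vectors is one product over
    \<open>Basis\<close>.\<close>
  proof -
    have "bij_betw (\<lambda>p. axis (fst p) (snd p)) (UNIV \<times> Basis) (Basis :: ('a ^ 'n) set)"
      by (force simp: bij_betw_def inj_on_def axis_eq_axis Basis_vec_def image_iff)
    from prod.reindex_bij_betw[OF this, of "\<lambda>b. (u - l) \<bullet> b"] show ?thesis
      by (simp add: case_prod_beta)
  qed
  finally show "emeasure (distr (PiM UNIV (\<lambda>_. lborel)) borel (\<lambda>f. \<chi> i. f i)) (box l u) =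
      ennreal (\<Prod>b\<in>Basis. (u - l) \<bullet> b)" .
qed simp

text \<open>Source of the factor pi and of the substitution t = d^2 in the final formula.\<close>

lemma integral_norm_square:
  fixes v :: "real \<Rightarrow> real"
  assumes "DIM('a::euclidean_space) = 2" and [measurable]: "v \<in> borel_measurable borel"
  shows "(\<integral>x. v ((norm x)\<^sup>2) \<partial>(lborel :: 'a measure)) = pi * (\<integral>t. indicator {0..} t * v t \<partial>lborel)"
proof -
  have "(\<integral>x. v ((norm x)\<^sup>2) \<partial>(lborel :: 'a measure)) = (\<integral>t. v t \<partial>distr lborel borel (\<lambda>x::'a. (norm x)\<^sup>2))"
    by (subst integral_distr) auto
  also have "\<dots> = (\<integral>t. v t \<partial>density lborel (\<lambda>t. ennreal (pi * indicator {0..} t)))"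
    by (simp add: distr_lborel_norm_square[OF assms(1)] ennreal_mult' ennreal_indicator)
  also have "\<dots> = (\<integral>t. (pi * indicator {0..} t) * v t \<partial>lborel)"
    by (subst integral_density) auto
  finally show ?thesis
    by (simp add: mult.assoc)
qed

text \<open>Passes from the Bochner integral to the gauge integral of the theorem. The left endpoint
  is left out because the integrand is uncontrolled there (\<open>G 0\<close> is arbitrary); one
  point does not change the integral.\<close>

lemma lebesgue_integral_eq_integral_Icc:
  fixes u :: "real \<Rightarrow> real"
  assumes "(\<lambda>t. indicator {0<..a} t * u t) \<in> borel_measurable borel"
    and "\<And>t. 0 < t \<Longrightarrow> t \<le> a \<Longrightarrow> \<bar>u t\<bar> \<le> 1"
  shows "(\<integral>t. indicator {0<..a} t * u t \<partial>lborel) = integral {0..a} u"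
proof -
  have "integrable lborel (\<lambda>t. indicator {0<..a} t * u t)"
  proof (rule Bochner_Integration.integrable_bound)
    show "integrable lborel (indicator {0<..a} :: real \<Rightarrow> real)"
      using emeasure_bounded_finite[of "{0<..a}"] by (simp add: integrable_indicator_iff)
  qed (use assms in \<open>auto simp: indicator_def\<close>)
  then have "((\<lambda>t. indicator {0<..a} t * u t) has_integral (\<integral>t. indicator {0<..a} t * u t \<partial>lborel)) UNIV"
    by (rule has_integral_integral_lborel)
  then have "((\<lambda>t. if t \<in> {0..a} then u t else 0) has_integral (\<integral>t. indicator {0<..a} t * u t \<partial>lborel)) UNIV"
    by (rule has_integral_spike[of "{0}", rotated 2]) (auto simp: indicator_def)
  then have "(u has_integral (\<integral>t. indicator {0<..a} t * u t \<partial>lborel)) {0..a}"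
    by (simp only: has_integral_restrict_UNIV)
  then show ?thesis
    by (rule integral_unique[symmetric])
qed

subsection \<open>Complex Gaussian vectors\<close>

text \<open>With variance 1/2 per part, each real density is exp(- x^2) / sqrt pi, so the product
  depends on the modulus only.\<close>

lemma std_complex_normal_eq:
  "std_complex_normal = density lborel (\<lambda>z. ennreal (exp (- (cmod z)\<^sup>2) / pi))"
proof -
  let ?n = "\<lambda>x. ennreal (normal_density 0 (sqrt (1/2)) x)"
  have n: "normal_density 0 (sqrt (1/2)) x = exp (- x\<^sup>2) / sqrt pi" for x
    by (simp add: normal_density_def real_sqrt_divide field_simps)
  have nn: "?n x * ?n y = ennreal (exp (- (cmod (Complex x y))\<^sup>2) / pi)" for x y
  proof -
    have "exp (- x\<^sup>2) / sqrt pi * (exp (- y\<^sup>2) / sqrt pi) = exp (- (cmod (Complex x y))\<^sup>2) / pi"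
      by (simp add: cmod_power2 mult_exp_exp)
    then show ?thesis
      by (simp add: n flip: ennreal_mult)
  qed
  have "sigma_finite_measure (density lborel ?n)"
    by (intro prob_space_imp_sigma_finite prob_space_normal_density) simp
  then have "density lborel ?n \<Otimes>\<^sub>M density lborel ?n =
      density (lborel \<Otimes>\<^sub>M lborel) (\<lambda>(x, y). ?n x * ?n y)"
    by (intro pair_measure_density) (auto intro: lborel.sigma_finite_measure_axioms)
  also have "\<dots> = density (lborel \<Otimes>\<^sub>M lborel)
      (\<lambda>p. ennreal (exp (- (cmod (case p of (x, y) \<Rightarrow> Complex x y))\<^sup>2) / pi))"
    by (intro arg_cong[where f = "density _"] ext) (simp add: nn split_beta)
  finally show ?thesis
    unfolding std_complex_normal_def
    by (subst lborel_complex_eq) (subst density_distr; simp)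
qed

text \<open>Encoded by a density in \<open>norm z\<close> alone, not as a product of coordinate
  laws, so that invariance under isometries can be read off.\<close>

definition std_complex_normal_vec :: "(complex ^ 'm::finite) measure" where
  "std_complex_normal_vec = density lborel (\<lambda>z. ennreal (exp (- (norm z)\<^sup>2) / pi ^ CARD('m)))"

lemma prob_space_std_complex_normal: "prob_space std_complex_normal"
proof -
  interpret N: prob_space "density lborel (normal_density 0 (sqrt (1/2)))"
    by (rule prob_space_normal_density) simp
  interpret pair_prob_space "density lborel (normal_density 0 (sqrt (1/2)))"
      "density lborel (normal_density 0 (sqrt (1/2)))" ..
  show ?thesis
    unfolding std_complex_normal_def by (rule prob_space_distr) simp
qed

lemma norm_vec_power2: "(norm x)\<^sup>2 = (\<Sum>i\<in>UNIV. (norm (x $ i))\<^sup>2)"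
  by (simp add: norm_vec_def L2_set_def sum_nonneg)

text \<open>Squared coordinate norms add up to the squared norm, so the coordinate densities
  multiply to a function of the norm.\<close>

lemma distr_PiM_std_complex_normal:
  "distr (PiM UNIV (\<lambda>_::'m::finite. std_complex_normal)) borel (\<lambda>f. \<chi> j. f j) = std_complex_normal_vec"
proof -
  let ?g = "\<lambda>z. ennreal (exp (- (cmod z)\<^sup>2) / pi)"
  have "PiM UNIV (\<lambda>_::'m. std_complex_normal) = density (PiM UNIV (\<lambda>_. lborel)) (\<lambda>f. \<Prod>j\<in>UNIV. ?g (f j))"
    using prob_space_imp_sigma_finite[OF prob_space_std_complex_normal]
    unfolding std_complex_normal_eq
    by (intro PiM_density) (auto intro: lborel.sigma_finite_measure_axioms)
  also have "(\<lambda>f. \<Prod>j\<in>UNIV. ?g (f j)) =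
      (\<lambda>f. ennreal (exp (- (norm (\<chi> j. f j :: complex ^ 'm))\<^sup>2) / pi ^ CARD('m)))"
    by (simp add: norm_vec_power2 prod_ennreal prod_dividef exp_sum flip: sum_negf)
  finally show ?thesis
    unfolding std_complex_normal_vec_def
    by (subst lborel_vec_eq) (subst density_distr; simp)
qed

lemma distr_std_complex_normal_vec_isometry:
  fixes T :: "complex ^ 'm::finite \<Rightarrow> complex ^ 'm"
  assumes "linear T" and "\<And>x. norm (T x) = norm x"
  shows "distr std_complex_normal_vec borel T = std_complex_normal_vec"
proof -
  have [measurable]: "T \<in> borel_measurable borel"
    by (intro borel_measurable_continuous_onI linear_continuous_on linear_linear[THEN iffD2] assms)
  have "std_complex_normal_vec =
      density (distr lborel borel T) (\<lambda>z::complex ^ 'm. ennreal (exp (- (norm z)\<^sup>2) / pi ^ CARD('m)))"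
    unfolding std_complex_normal_vec_def by (subst distr_lborel_isometry) (use assms in auto)
  also have "\<dots> = distr std_complex_normal_vec borel T"
    unfolding std_complex_normal_vec_def by (subst density_distr) (auto simp: assms)
  finally show ?thesis ..
qed

lemma orthonormal_beams_isometry:
  assumes "orthonormal_beams b"
  shows "norm (\<chi> k. \<Sum>j\<in>UNIV. x $ j * b k $ j) = norm x"
proof -
  let ?T = "\<chi> k. \<Sum>j\<in>UNIV. x $ j * b k $ j"
  let ?B = "\<chi> k j. b k $ j" and ?C = "\<chi> j k. cnj (b k $ j)"
  have "?B ** ?C = mat 1"
    using assms by (simp add: orthonormal_beams_def matrix_matrix_mult_def mat_def vec_eq_iff)
  \<comment> \<open>There are as many beams as antennas, so the matrix of beams is square and
    orthonormal rows give orthonormal columns. The columns are what the expansion of the squared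
    norm needs, since it sums over beams.\<close>
  then have "?C ** ?B = mat 1"
    by (simp add: matrix_left_right_inverse)
  then have *: "(\<Sum>k\<in>UNIV. cnj (b k $ j) * b k $ l) = (if j = l then 1 else 0)" for j l
    by (simp add: matrix_matrix_mult_def mat_def vec_eq_iff)
  have "complex_of_real ((norm ?T)\<^sup>2) = (\<Sum>k\<in>UNIV. ?T $ k * cnj (?T $ k))"
    by (simp add: norm_vec_power2 complex_norm_square del: vec_lambda_beta of_real_power)
  also have "\<dots> = (\<Sum>k\<in>UNIV. \<Sum>l\<in>UNIV. \<Sum>j\<in>UNIV. x $ l * cnj (x $ j) * (cnj (b k $ j) * b k $ l))"
    by (simp add: sum_product mult_ac)
  also have "\<dots> = (\<Sum>l\<in>UNIV. \<Sum>j\<in>UNIV. \<Sum>k\<in>UNIV. x $ l * cnj (x $ j) * (cnj (b k $ j) * b k $ l))"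
    by (subst sum.swap) (intro sum.cong refl sum.swap)
  also have "\<dots> = (\<Sum>l\<in>UNIV. \<Sum>j\<in>UNIV. x $ l * cnj (x $ j) * (if j = l then 1 else 0))"
    by (simp add: * flip: sum_distrib_left)
  also have "\<dots> = complex_of_real ((norm x)\<^sup>2)"
    by (simp add: norm_vec_power2 complex_norm_square if_distrib del: of_real_power cong: if_cong)
  finally have "(norm ?T)\<^sup>2 = (norm x)\<^sup>2"
    by (simp only: of_real_eq_iff)
  then show ?thesis
    by (simp add: power2_eq_iff_nonneg)
qed

text \<open>The constant density pi of the squared modulus cancels the 1 / pi of the Gaussian. The
  target is \<open>lborel\<close> to fit \<open>distributed\<close>.\<close>

lemma distr_std_complex_normal_norm_square:
  "distr std_complex_normal lborel (\<lambda>z. (cmod z)\<^sup>2) = density lborel (exponential_density 1)"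
proof -
  have "distr std_complex_normal lborel (\<lambda>z. (cmod z)\<^sup>2) =
      distr (density lborel (\<lambda>z. ennreal (exp (- (cmod z)\<^sup>2) / pi))) borel (\<lambda>z. (cmod z)\<^sup>2)"
    unfolding std_complex_normal_eq by (rule distr_cong) simp_all
  also have "\<dots> = density (distr lborel borel (\<lambda>z::complex. (norm z)\<^sup>2)) (\<lambda>t. ennreal (exp (- t) / pi))"
    by (subst density_distr) auto
  also have "\<dots> = density lborel (\<lambda>t. ennreal pi * indicator {0..} t * ennreal (exp (- t) / pi))"
    by (subst distr_lborel_norm_square) (simp_all add: density_density_eq)
  also have "\<dots> = density lborel (exponential_density 1)"
    by (intro arg_cong[where f = "density lborel"] ext)
      (simp add: exponential_density_def indicator_def flip: ennreal_mult)
  finally show ?thesis .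
qed

subsection \<open>Independence and conditioning\<close>

text \<open>Serves to extract the antenna components of one user from the family indexed by pairs of
  user and antenna.\<close>

lemma (in prob_space) indep_vars_reindex:
  assumes inj: "inj_on f I" and ind: "indep_vars M' X (f ` I)"
  shows "indep_vars (\<lambda>i. M' (f i)) (\<lambda>i. X (f i)) I"
  unfolding indep_vars_def
proof (intro conjI ballI indep_setsI)
  let ?F = "\<lambda>i. {X i -` A \<inter> space M | A. A \<in> sets (M' i)}"
  have rv: "random_variable (M' (f i)) (X (f i))" if "i \<in> I" for i
    using ind that by (auto simp: indep_vars_def)
  then show "random_variable (M' (f i)) (X (f i))" if "i \<in> I" for i
    using that .
  show "sigma_sets (space M) (?F (f i)) \<subseteq> events" if "i \<in> I" for i
    using rv[OF that] by (intro sets.sigma_sets_subset) auto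
  fix A J assume J: "J \<noteq> {}" "J \<subseteq> I" "finite J" and A: "\<forall>j\<in>J. A j \<in> sigma_sets (space M) (?F (f j))"
  have inv: "the_inv_into J f (f j) = j" if "j \<in> J" for j
    using inj_on_subset[OF inj J(2)] that by (rule the_inv_into_f_f)
  have "prob (\<Inter>k\<in>f ` J. A (the_inv_into J f k)) = (\<Prod>k\<in>f ` J. prob (A (the_inv_into J f k)))"
    using ind J A by (intro indep_setsD[of "\<lambda>i. sigma_sets (space M) (?F i)" "f ` I"])
      (auto simp: indep_vars_def inv)
  then show "prob (\<Inter>j\<in>J. A j) = (\<Prod>j\<in>J. prob (A j))"
    using inj_on_subset[OF inj J(2)] by (simp add: inv prod.reindex cong: INF_cong_simp)
qed

text \<open>Fubini as conditioning: \<open>X\<close> is frozen while \<open>Y\<close> stays random.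
  Independence enters as a product law so that it can come from either \<open>indep_var\<close> or
  \<open>indep_rv\<close>.\<close>

lemma (in prob_space) prob_joint_eq_expectation:
  assumes X[measurable]: "random_variable S X" and Y[measurable]: "random_variable T Y"
    and joint: "distr M S X \<Otimes>\<^sub>M distr M T Y = distr M (S \<Otimes>\<^sub>M T) (\<lambda>\<omega>. (X \<omega>, Y \<omega>))"
    and Q[measurable]: "Measurable.pred (S \<Otimes>\<^sub>M T) (\<lambda>(x, y). Q x y)"
  shows "(\<lambda>\<omega>'. \<P>(\<omega> in M. Q (X \<omega>') (Y \<omega>))) \<in> borel_measurable M" (is ?meas)
    and "\<P>(\<omega> in M. Q (X \<omega>) (Y \<omega>)) = expectation (\<lambda>\<omega>'. \<P>(\<omega> in M. Q (X \<omega>') (Y \<omega>)))" (is ?eq)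
proof -
  interpret X: prob_space "distr M S X" by (rule prob_space_distr) fact
  interpret Y: prob_space "distr M T Y" by (rule prob_space_distr) fact
  define A where "A = {p \<in> space (S \<Otimes>\<^sub>M T). Q (fst p) (snd p)}"
  have A[measurable]: "A \<in> sets (S \<Otimes>\<^sub>M T)"
    unfolding A_def using Q by (simp add: case_prod_beta pred_def)
  have A': "A \<in> sets (distr M S X \<Otimes>\<^sub>M distr M T Y)"
    using A by (simp cong: sets_pair_measure_cong)
  have slice: "emeasure (distr M T Y) (Pair x -` A) = \<P>(\<omega> in M. Q x (Y \<omega>))" if "x \<in> space S" for x
    using that measurable_space[OF Y] sets_Pair1[OF A, of x]
    by (subst emeasure_distr)
      (auto simp: emeasure_eq_measure A_def space_pair_measure intro!: arg_cong[where f = prob])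
  have "(\<lambda>x. emeasure (distr M T Y) (Pair x -` A)) \<in> borel_measurable (distr M S X)"
    by (rule Y.measurable_emeasure_Pair) fact
  then have "(\<lambda>\<omega>'. emeasure (distr M T Y) (Pair (X \<omega>') -` A)) \<in> borel_measurable M"
    by measurable
  then have m: "(\<lambda>\<omega>'. ennreal (\<P>(\<omega> in M. Q (X \<omega>') (Y \<omega>)))) \<in> borel_measurable M"
    by (rule measurable_cong[THEN iffD1, rotated]) (simp add: slice measurable_space[OF X])
  then have "(\<lambda>\<omega>'. enn2real (ennreal (\<P>(\<omega> in M. Q (X \<omega>') (Y \<omega>))))) \<in> borel_measurable M"
    by (rule borel_measurable_enn2real)
  then show ?meas by simp
  have "ennreal (\<P>(\<omega> in M. Q (X \<omega>) (Y \<omega>))) = emeasure (distr M (S \<Otimes>\<^sub>M T) (\<lambda>\<omega>. (X \<omega>, Y \<omega>))) A"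
    using measurable_space[OF X] measurable_space[OF Y]
    by (subst emeasure_distr)
      (auto simp: emeasure_eq_measure A_def space_pair_measure intro!: arg_cong[where f = prob])
  also have "\<dots> = (\<integral>\<^sup>+x. emeasure (distr M T Y) (Pair x -` A) \<partial>distr M S X)"
    by (subst joint[symmetric]) (rule Y.emeasure_pair_measure_alt[OF A'])
  also have "\<dots> = (\<integral>\<^sup>+\<omega>'. emeasure (distr M T Y) (Pair (X \<omega>') -` A) \<partial>M)"
    by (subst nn_integral_distr) (use Y.measurable_emeasure_Pair[OF A'] in simp_all)
  also have "\<dots> = (\<integral>\<^sup>+\<omega>'. ennreal (\<P>(\<omega> in M. Q (X \<omega>') (Y \<omega>))) \<partial>M)"
    by (intro nn_integral_cong) (simp add: slice measurable_space[OF X])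
  also have "\<dots> = ennreal (expectation (\<lambda>\<omega>'. \<P>(\<omega> in M. Q (X \<omega>') (Y \<omega>))))"
    by (intro nn_integral_eq_integral integrable_const_bound[where B = 1])
      (use \<open>?meas\<close> in auto)
  finally show ?eq
    by (simp add: integral_nonneg)
qed

lemma (in prob_space) indep_rv_distr:
  assumes "indep_rv S X T Y"
  shows "distr M S X \<Otimes>\<^sub>M distr M T Y = distr M (S \<Otimes>\<^sub>M T) (\<lambda>\<omega>. (X \<omega>, Y \<omega>))"
proof (rule pair_measure_eqI)
  have [measurable]: "random_variable S X" "random_variable T Y"
    using assms by (auto simp: indep_rv_def)
  interpret X: prob_space "distr M S X" by (rule prob_space_distr) fact
  interpret Y: prob_space "distr M T Y" by (rule prob_space_distr) fact
  show "sigma_finite_measure (distr M S X)" "sigma_finite_measure (distr M T Y)" ..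
  show "sets (distr M S X \<Otimes>\<^sub>M distr M T Y) = sets (distr M (S \<Otimes>\<^sub>M T) (\<lambda>\<omega>. (X \<omega>, Y \<omega>)))"
    by (simp cong: sets_pair_measure_cong)
  fix A B assume "A \<in> sets (distr M S X)" "B \<in> sets (distr M T Y)"
  then have AB[measurable]: "A \<in> sets S" "B \<in> sets T" by auto
  have "prob ((X -` A \<inter> space M) \<inter> (Y -` B \<inter> space M)) = prob (X -` A \<inter> space M) * prob (Y -` B \<inter> space M)"
    using assms AB by (intro indep_setD) (auto simp: indep_rv_def)
  also have "(X -` A \<inter> space M) \<inter> (Y -` B \<inter> space M) = (\<lambda>\<omega>. (X \<omega>, Y \<omega>)) -` (A \<times> B) \<inter> space M"
    by auto
  finally show "emeasure (distr M S X) A * emeasure (distr M T Y) B =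
      emeasure (distr M (S \<Otimes>\<^sub>M T) (\<lambda>\<omega>. (X \<omega>, Y \<omega>))) (A \<times> B)"
    by (simp add: emeasure_distr emeasure_eq_measure flip: ennreal_mult)
qed

text \<open>The variable to be frozen has to come first in the joint law, whatever the order in
  which independence was stated.\<close>

lemma (in prob_space) joint_distr_swap:
  assumes [measurable]: "random_variable S X" "random_variable T Y"
    and joint: "distr M S X \<Otimes>\<^sub>M distr M T Y = distr M (S \<Otimes>\<^sub>M T) (\<lambda>\<omega>. (X \<omega>, Y \<omega>))"
  shows "distr M T Y \<Otimes>\<^sub>M distr M S X = distr M (T \<Otimes>\<^sub>M S) (\<lambda>\<omega>. (Y \<omega>, X \<omega>))"
proof -
  interpret X: prob_space "distr M S X" by (rule prob_space_distr) fact
  interpret Y: prob_space "distr M T Y" by (rule prob_space_distr) fact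
  interpret pair_sigma_finite "distr M T Y" "distr M S X" ..
  have "distr M T Y \<Otimes>\<^sub>M distr M S X =
      distr (distr M (S \<Otimes>\<^sub>M T) (\<lambda>\<omega>. (X \<omega>, Y \<omega>))) (T \<Otimes>\<^sub>M S) (\<lambda>(x, y). (y, x))"
    by (subst distr_pair_swap, subst joint) (intro distr_cong refl sets_pair_measure_cong sets_distr)
  also have "\<dots> = distr M (T \<Otimes>\<^sub>M S) (\<lambda>\<omega>. (Y \<omega>, X \<omega>))"
    by (subst distr_distr) (auto simp: comp_def)
  finally show ?thesis .
qed

subsection \<open>The SINR of a single user\<close>

text \<open>Conditioning on the interference turns the event into an exponential tail, whose expectation
  factors into Laplace transforms of exponential variables.\<close>

lemma (in prob_space) prob_exponential_sinr:
  fixes E :: "'m::finite \<Rightarrow> 'a \<Rightarrow> real"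
  assumes ind: "indep_vars (\<lambda>_. borel) E UNIV"
    and E: "\<And>k. distributed M lborel (E k) (exponential_density 1)"
    and nonneg: "\<And>k \<omega>. E k \<omega> \<ge> 0" and "c > 0" "y \<ge> 0"
  shows "\<P>(\<omega> in M. E m \<omega> / (c + (\<Sum>k\<in>UNIV - {m}. E k \<omega>)) \<le> y) =
    1 - exp (- y * c) / (1 + y) ^ (CARD('m) - 1)"
proof -
  have [measurable]: "random_variable borel (E k)" for k
    using distributed_measurable[OF E[of k]] by simp
  define I where "I = (\<lambda>\<omega>. \<Sum>k\<in>UNIV - {m}. E k \<omega>)"
  have I[measurable]: "random_variable borel I" by (simp add: I_def)
  have Inn: "I \<omega> \<ge> 0" for \<omega> by (simp add: I_def nonneg sum_nonneg)
  have "indep_var borel (E m) borel I"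
    unfolding I_def using ind by (intro indep_vars_sum) (auto simp: insert_absorb)
  then have joint: "distr M borel I \<Otimes>\<^sub>M distr M borel (E m) = distr M (borel \<Otimes>\<^sub>M borel) (\<lambda>\<omega>. (I \<omega>, E m \<omega>))"
    using joint_distr_swap[where X = "E m" and S = borel and Y = I and T = borel] by (simp add: indep_var_distribution_eq)
  have laplace: "expectation (\<lambda>\<omega>. exp (- y * E k \<omega>)) = 1 / (1 + y)" for k
  proof -
    have "expectation (\<lambda>\<omega>. exp (- y * E k \<omega>)) = (\<integral>x. exponential_density 1 x * exp (- y * x) \<partial>lborel)"
      by (intro distributed_integral[OF E, symmetric]) (auto simp: exponential_density_nonneg)
    also have "\<dots> = (\<integral>x. exponential_density (1 + y) x * (1 / (1 + y)) \<partial>lborel)"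
    proof (rule Bochner_Integration.integral_cong[OF refl])
      fix x
      have "1 + y \<noteq> 0" using \<open>y \<ge> 0\<close> by simp
      then show "exponential_density 1 x * exp (- y * x) = exponential_density (1 + y) x * (1 / (1 + y))"
        by (simp add: exponential_density_def mult_exp_exp distrib_left mult.commute)
    qed
    \<comment> \<open>The total mass of the exponential density is its zeroth moment, the Erlang
      moment formula with both indices 0.\<close>
    also have "\<dots> = 1 / (1 + y)"
      using \<open>y \<ge> 0\<close> nn_integral_erlang_ith_moment[of "1 + y" 0 0]
      by (simp add: integral_eq_nn_integral exponential_density_nonneg)
    finally show ?thesis .
  qed
  have tail: "\<P>(\<omega> in M. y * (c + s) < E m \<omega>) = exp (- (y * (c + s)))" if "s \<ge> 0" for s
    using exponential_distributedD_gt[OF E[of m], of "y * (c + s)"] that assms by simp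
  have "\<P>(\<omega> in M. y * (c + I \<omega>) < E m \<omega>) =
      expectation (\<lambda>\<omega>'. \<P>(\<omega> in M. y * (c + I \<omega>') < E m \<omega>))"
    by (rule prob_joint_eq_expectation[OF _ _ joint]) simp_all
  also have "\<dots> = expectation (\<lambda>\<omega>. exp (- y * c) * (\<Prod>k\<in>UNIV - {m}. exp (- y * E k \<omega>)))"
  proof (rule Bochner_Integration.integral_cong[OF refl])
    fix \<omega>
    have "exp (- y * c) * (\<Prod>k\<in>UNIV - {m}. exp (- y * E k \<omega>)) = exp (- (y * (c + I \<omega>)))"
      by (simp add: I_def sum_distrib_left sum_negf mult_exp_exp distrib_left flip: exp_sum)
    then show "\<P>(\<omega>' in M. y * (c + I \<omega>) < E m \<omega>') =
        exp (- y * c) * (\<Prod>k\<in>UNIV - {m}. exp (- y * E k \<omega>))"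
      by (simp only: tail[OF Inn])
  qed
  also have "\<dots> = exp (- y * c) * (\<Prod>k\<in>UNIV - {m}. expectation (\<lambda>\<omega>. exp (- y * E k \<omega>)))"
  proof (subst integral_mult_right_zero, rule arg_cong[where f = "(*) _"], rule indep_vars_lebesgue_integral)
    show "indep_vars (\<lambda>_. borel) (\<lambda>k \<omega>. exp (- y * E k \<omega>)) (UNIV - {m})"
      by (rule indep_vars_compose2[OF indep_vars_subset[OF ind]]) auto
    show "integrable M (\<lambda>\<omega>. exp (- y * E k \<omega>))" for k
      using \<open>y \<ge> 0\<close> by (intro integrable_const_bound[where B = 1]) (auto simp: nonneg)
  qed simp
  also have "\<dots> = exp (- y * c) / (1 + y) ^ (CARD('m) - 1)"
    unfolding laplace by (simp add: card_Diff_singleton power_divide)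
  finally have "\<P>(\<omega> in M. y * (c + I \<omega>) < E m \<omega>) = exp (- y * c) / (1 + y) ^ (CARD('m) - 1)" .
  moreover have "\<P>(\<omega> in M. E m \<omega> / (c + I \<omega>) \<le> y) = 1 - \<P>(\<omega> in M. y * (c + I \<omega>) < E m \<omega>)"
  proof -
    have pos: "c + I \<omega> > 0" for \<omega> using Inn[of \<omega>] \<open>c > 0\<close> by linarith
    show ?thesis
      by (subst prob_neg[symmetric]) (simp_all add: divide_le_eq pos not_less)
  qed
  ultimately show ?thesis by (simp add: I_def)
qed

lemma borel_measurable_beam_gain [measurable]:
  assumes [measurable]: "f \<in> borel_measurable N" "g \<in> borel_measurable N"
  shows "(\<lambda>\<omega>. beam_gain (f \<omega>) (g \<omega>)) \<in> borel_measurable N"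
  unfolding beam_gain_def by measurable

lemma borel_measurable_sinr [measurable]:
  assumes [measurable]: "g \<in> borel_measurable N" "f \<in> borel_measurable N" "\<And>k. b k \<in> borel_measurable N"
  shows "(\<lambda>\<omega>. sinr \<rho> (g \<omega>) (f \<omega>) (\<lambda>k. b k \<omega>) m) \<in> borel_measurable N"
  unfolding sinr_def by measurable

lemma sinr_nonneg: "g > 0 \<Longrightarrow> \<rho> > 0 \<Longrightarrow> sinr \<rho> g z b m \<ge> 0"
  by (auto simp: sinr_def beam_gain_def intro!: divide_nonneg_nonneg add_nonneg_nonneg sum_nonneg)

text \<open>The vector of beam products is a linear isometry applied to \<open>H\<close>, hence has
  the law of \<open>H\<close> itself. The beams may thus be replaced by the coordinate axes, where
  the gains are independent exponentials.\<close>

lemma (in prob_space) prob_sinr_le: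
  fixes H :: "'a \<Rightarrow> complex ^ 'm::finite"
  assumes ind: "indep_vars (\<lambda>_. borel) (\<lambda>j \<omega>. H \<omega> $ j) UNIV"
    and law: "\<And>j. distr M borel (\<lambda>\<omega>. H \<omega> $ j) = std_complex_normal"
    and orth: "orthonormal_beams b" and pos: "g > 0" "\<rho> > 0" and "y \<ge> 0"
  shows "\<P>(\<omega> in M. sinr \<rho> g (H \<omega>) b m \<le> y) = 1 - exp (- y / (g * \<rho>)) / (1 + y) ^ (CARD('m) - 1)"
proof -
  let ?c = "inverse (\<rho> * g)"
  let ?T = "\<lambda>z :: complex ^ 'm. \<chi> k. \<Sum>j\<in>UNIV. z $ j * b k $ j"
  \<comment> \<open>The SINR event for beams along the axes; applied to \<open>?T\<close> of the
    fading vector it is the original event.\<close>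
  define Q where "Q z \<longleftrightarrow> (cmod (z $ m))\<^sup>2 / (?c + (\<Sum>k\<in>UNIV - {m}. (cmod (z $ k))\<^sup>2)) \<le> y" for z :: "complex ^ 'm"
  have Q[measurable]: "Measurable.pred borel Q"
    unfolding Q_def by measurable
  have Hj[measurable]: "random_variable borel (\<lambda>\<omega>. H \<omega> $ j)" for j
    using ind by (auto simp: indep_vars_def)
  have "(\<lambda>\<omega>. \<chi> j. H \<omega> $ j) \<in> borel_measurable M"
    by (rule measurable_compose[OF _ borel_measurable_vec_lambda]) (intro measurable_PiM_single'; simp)
  then have H[measurable]: "random_variable borel H" by simp
  have lin: "linear ?T"
    by (rule linearI) (simp_all add: vec_eq_iff distrib_right sum.distrib scaleR_sum_right)
  have T[measurable]: "?T \<in> borel_measurable borel"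
    by (intro borel_measurable_continuous_onI linear_continuous_on linear_linear[THEN iffD2] lin)
  have "distr M (PiM UNIV (\<lambda>_. borel)) (\<lambda>\<omega>. \<lambda>j\<in>UNIV. H \<omega> $ j) = PiM UNIV (\<lambda>_. std_complex_normal)"
    using indep_vars_iff_distr_eq_PiM[THEN iffD1, OF _ Hj ind] by (simp add: law)
  then have "std_complex_normal_vec = distr (distr M (PiM UNIV (\<lambda>_. borel)) (\<lambda>\<omega>. \<lambda>j\<in>UNIV. H \<omega> $ j)) borel (\<lambda>f. \<chi> j. f j)"
    by (simp add: distr_PiM_std_complex_normal)
  also have "\<dots> = distr M borel H"
    by (subst distr_distr) (auto simp: comp_def restrict_def intro!: measurable_PiM_single')
  finally have "distr M borel H = std_complex_normal_vec" ..
  then have TH: "distr M borel (\<lambda>\<omega>. ?T (H \<omega>)) = distr M borel H"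
    using distr_std_complex_normal_vec_isometry[OF lin orthonormal_beams_isometry[OF orth]]
      distr_distr[OF T H] by (simp add: comp_def)
  have pr: "\<P>(\<omega> in M. Q (Z \<omega>)) = measure (distr M borel Z) {z. Q z}" if [measurable]: "random_variable borel Z" for Z
    by (subst measure_distr) (auto intro: arg_cong[where f = prob])
  have "\<P>(\<omega> in M. sinr \<rho> g (H \<omega>) b m \<le> y) = \<P>(\<omega> in M. Q (?T (H \<omega>)))"
    by (simp add: Q_def sinr_def beam_gain_def)
  also have "\<dots> = \<P>(\<omega> in M. Q (H \<omega>))"
    by (simp add: pr TH)
  also have "\<dots> = 1 - exp (- y * ?c) / (1 + y) ^ (CARD('m) - 1)"
    unfolding Q_def
  proof (rule prob_exponential_sinr)
    show "indep_vars (\<lambda>_. borel) (\<lambda>k \<omega>. (cmod (H \<omega> $ k))\<^sup>2) UNIV"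
      by (rule indep_vars_compose2[OF ind]) simp
    show "distributed M lborel (\<lambda>\<omega>. (cmod (H \<omega> $ k))\<^sup>2) (exponential_density 1)" for k
    proof -
      have "distr (distr M borel (\<lambda>\<omega>. H \<omega> $ k)) lborel (\<lambda>z. (cmod z)\<^sup>2) = distr M lborel (\<lambda>\<omega>. (cmod (H \<omega> $ k))\<^sup>2)"
        by (subst distr_distr) (auto simp: comp_def)
      then show ?thesis
        by (simp add: distributed_def law distr_std_complex_normal_norm_square)
    qed
  qed (use pos \<open>y \<ge> 0\<close> in auto)
  finally show ?thesis
    by (simp add: divide_inverse mult.commute)
qed

subsection \<open>The generating functional of a Poisson process\<close>

lemma (in prob_space) poisson_power_expectation:
  fixes c :: real
  assumes [measurable]: "random_variable (count_space UNIV) N"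
    and N: "\<And>k. \<P>(\<omega> in M. N \<omega> = k) = \<mu> ^ k / fact k * exp (- \<mu>)" and "\<mu> \<ge> 0"
  shows "expectation (\<lambda>\<omega>. c ^ N \<omega>) = exp (- (\<mu> * (1 - c)))"
proof -
  have d: "distr M (count_space UNIV) N = density (count_space UNIV) (\<lambda>k. ennreal (\<mu> ^ k / fact k * exp (- \<mu>)))"
  proof (rule measure_eqI_countable[where A = UNIV])
    fix k
    have "emeasure (distr M (count_space UNIV) N) {k} = \<P>(\<omega> in M. N \<omega> = k)"
      by (subst emeasure_distr) (auto simp: emeasure_eq_measure intro!: arg_cong[where f = prob])
    then show "emeasure (distr M (count_space UNIV) N) {k} =
        emeasure (density (count_space UNIV) (\<lambda>k. ennreal (\<mu> ^ k / fact k * exp (- \<mu>)))) {k}"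
      by (simp add: N emeasure_density nn_integral_count_space_indicator[symmetric])
  qed auto
  have s: "(\<lambda>k. \<mu> ^ k / fact k * exp (- \<mu>) * c ^ k) sums (exp (\<mu> * c) * exp (- \<mu>))" for c
    using sums_mult2[OF exp_converges[of "\<mu> * c"], of "exp (- \<mu>)"]
    by (simp add: field_simps power_mult_distrib)
  have "expectation (\<lambda>\<omega>. c ^ N \<omega>) = (\<integral>k. c ^ k \<partial>distr M (count_space UNIV) N)"
    by (subst integral_distr) simp_all
  also have "\<dots> = (\<integral>k. \<mu> ^ k / fact k * exp (- \<mu>) * c ^ k \<partial>count_space UNIV)"
    unfolding d using \<open>\<mu> \<ge> 0\<close> by (subst integral_density) auto
  \<comment> \<open>Absolute summability holds because the same exponential series converges at the
    absolute value of \<open>c\<close>.\<close>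
  also have "\<dots> = (\<Sum>k. \<mu> ^ k / fact k * exp (- \<mu>) * c ^ k)"
    using s[of "\<bar>c\<bar>"] \<open>\<mu> \<ge> 0\<close>
    by (intro integral_count_space_nat) (auto simp: integrable_count_space_nat_iff abs_mult power_abs dest: sums_summable)
  also have "\<dots> = exp (- (\<mu> * (1 - c)))"
    using sums_unique[OF s[of c]] by (simp add: mult_exp_exp algebra_simps)
  finally show ?thesis .
qed

section \<open>Expectations of products over the points of a Poisson process\<close>

context prob_space
begin

context
  fixes lam :: real and X :: "nat \<Rightarrow> 'a \<Rightarrow> 'b::euclidean_space"
  assumes lam: "lam \<ge> 0" and ppp: "homogeneous_ppp lam X"
begin

lemma ppp_measurable: "random_variable borel (X i)"
  using ppp by (simp add: homogeneous_ppp_def)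

lemma ppp_AE_finite:
  assumes "A \<in> sets borel" "bounded A"
  shows "AE \<omega> in M. finite {i. X i \<omega> \<in> A}"
  using ppp assms by (simp add: homogeneous_ppp_def)

lemma measurable_point_count:
  assumes "A \<in> sets borel" "bounded A"
  shows "random_variable (count_space UNIV) (point_count X A)"
proof -
  have "indep_vars (\<lambda>_. count_space UNIV) (point_count X) {A}"
    using ppp assms by (auto simp: homogeneous_ppp_def)
  then show ?thesis
    by (auto simp: indep_vars_def)
qed

lemma prob_point_count:
  assumes "A \<in> sets borel" "bounded A"
  shows "\<P>(\<omega> in M. point_count X A \<omega> = k) =
    (lam * measure lborel A) ^ k / fact k * exp (- (lam * measure lborel A))"
  using ppp assms by (simp add: homogeneous_ppp_def)

text \<open>A singleton has measure 0, so its count is almost surely 0. Finiteness is added because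
  \<open>card\<close> is also 0 on infinite sets.\<close>

lemma ppp_AE_avoids_point: "AE \<omega> in M. \<forall>i. X i \<omega> \<noteq> x"
proof -
  have [measurable]: "random_variable (count_space UNIV) (point_count X {x})"
    by (rule measurable_point_count) auto
  have "\<P>(\<omega> in M. point_count X {x} \<omega> = 0) = 1"
    by (subst prob_point_count) (simp_all add: measure_def)
  then have "AE \<omega> in M. point_count X {x} \<omega> = 0"
    by (subst (asm) prob_eq_1) auto
  moreover have "AE \<omega> in M. finite {i. X i \<omega> \<in> {x}}"
    by (rule ppp_AE_finite) auto
  ultimately show ?thesis
    by eventually_elim (auto simp: point_count_def)
qed

lemma ppp_expectation_power:
  assumes "A \<in> sets borel" "bounded A"
  shows "expectation (\<lambda>\<omega>. c ^ point_count X A \<omega>) = exp (- (lam * measure lborel A * (1 - c)))"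
  using lam assms
  by (intro poisson_power_expectation measurable_point_count prob_point_count) simp_all

lemma borel_measurable_ppp_prod:
  fixes f :: "'b \<Rightarrow> real"
  assumes [measurable]: "A \<in> sets borel" "f \<in> borel_measurable borel"
  shows "(\<lambda>\<omega>. \<Prod>i\<in>{i. X i \<omega> \<in> A}. f (X i \<omega>)) \<in> borel_measurable M"
proof -
  note ppp_measurable[measurable]
  have [measurable]: "Measurable.pred M (\<lambda>\<omega>. finite {i. X i \<omega> \<in> A})"
    unfolding finite_nat_set_iff_bounded by simp
  \<comment> \<open>Finite products with factor 1 outside \<open>A\<close> replace the random index
    set; they are eventually constant. On an infinite index set \<open>prod\<close> is 1, which the
    outer \<open>else\<close> matches.\<close>
  let ?p = "\<lambda>n \<omega>. if finite {i. X i \<omega> \<in> A} then \<Prod>i<n. if X i \<omega> \<in> A then f (X i \<omega>) else 1 else 1"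
  show ?thesis
  proof (rule borel_measurable_LIMSEQ_real[where u = ?p])
    show "?p n \<in> borel_measurable M" for n by measurable
    fix \<omega>
    show "(\<lambda>n. ?p n \<omega>) \<longlonglongrightarrow> (\<Prod>i\<in>{i. X i \<omega> \<in> A}. f (X i \<omega>))"
    proof (cases "finite {i. X i \<omega> \<in> A}")
      case True
      then obtain n0 where n0: "\<And>i. X i \<omega> \<in> A \<Longrightarrow> i < n0"
        by (auto simp: finite_nat_set_iff_bounded)
      have "?p n \<omega> = (\<Prod>i\<in>{i. X i \<omega> \<in> A}. f (X i \<omega>))" if "n \<ge> n0" for n
      proof -
        have "{i. X i \<omega> \<in> A} = {i \<in> {..<n}. X i \<omega> \<in> A}"
          using n0 that by (auto intro: less_le_trans)
        then show ?thesis
          using True by (simp only: prod.inter_filter[OF finite_lessThan] if_True)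
      qed
      then show ?thesis
        by (intro tendsto_eventually eventually_sequentiallyI)
    qed simp
  qed
qed

text \<open>The level sets of \<open>f\<close> split \<open>A\<close> into disjoint pieces with
  independent Poisson counts, and the product is a product of powers of the values to these
  counts.\<close>

lemma ppp_expectation_prod_simple:
  fixes f :: "'b \<Rightarrow> real"
  assumes [measurable]: "A \<in> sets borel" and "bounded A" and f: "simple_function borel f"
    and f01: "\<And>x. 0 \<le> f x" "\<And>x. f x \<le> 1"
  shows "expectation (\<lambda>\<omega>. \<Prod>i\<in>{i. X i \<omega> \<in> A}. f (X i \<omega>)) =
    exp (- (lam * (\<integral>x\<in>A. (1 - f x) \<partial>lborel)))"
proof -
  define B where "B c = {x \<in> A. f x = c}" for c
  \<comment> \<open>Nonempty level sets of distinct values are distinct, so \<open>B\<close> is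
    injective here. This matters because independence of counts is indexed by the sets;
    \<open>the_inv_into C B\<close> recovers the value from its set.\<close>
  define C where "C = {c \<in> f ` A. B c \<noteq> {}}"
  have fin: "finite C"
    using f by (auto simp: C_def simple_function_def intro: finite_subset[of _ "range f"])
  have [measurable]: "f \<in> borel_measurable borel"
    using f by (rule borel_measurable_simple_function)
  have B[measurable]: "B c \<in> sets borel" for c
    by (simp add: B_def)
  have Bb: "bounded (B c)" for c
    using \<open>bounded A\<close> by (rule bounded_subset) (auto simp: B_def)
  have inj: "inj_on B C"
    by (auto simp: inj_on_def B_def C_def)
  have "disjoint (B ` C)"
    by (auto simp: disjoint_def B_def)
  then have ind: "indep_vars (\<lambda>_. count_space UNIV) (point_count X) (B ` C)"
    using ppp fin B Bb by (auto simp: homogeneous_ppp_def)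
  have "expectation (\<lambda>\<omega>. \<Prod>i\<in>{i. X i \<omega> \<in> A}. f (X i \<omega>)) =
      expectation (\<lambda>\<omega>. \<Prod>S\<in>B ` C. the_inv_into C B S ^ point_count X S \<omega>)"
  proof (rule integral_cong_AE)
    show "AE \<omega> in M. (\<Prod>i\<in>{i. X i \<omega> \<in> A}. f (X i \<omega>)) =
        (\<Prod>S\<in>B ` C. the_inv_into C B S ^ point_count X S \<omega>)"
      using ppp_AE_finite[OF \<open>A \<in> sets borel\<close> \<open>bounded A\<close>]
    proof eventually_elim
      case (elim \<omega>)
      have "(\<Prod>i\<in>{i. X i \<omega> \<in> A}. f (X i \<omega>)) =
          (\<Prod>c\<in>C. \<Prod>i\<in>{i \<in> {i. X i \<omega> \<in> A}. f (X i \<omega>) = c}. f (X i \<omega>))"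
        using elim fin by (intro prod.group[symmetric]) (auto simp: C_def B_def)
      also have "\<dots> = (\<Prod>c\<in>C. \<Prod>i\<in>{i. X i \<omega> \<in> B c}. c)"
        by (intro prod.cong) (auto simp: B_def)
      also have "\<dots> = (\<Prod>c\<in>C. c ^ point_count X (B c) \<omega>)"
        by (simp add: point_count_def)
      finally show ?case
        by (simp add: prod.reindex[OF inj] the_inv_into_f_f[OF inj])
    qed
    have "random_variable (count_space UNIV) (point_count X S)" if "S \<in> B ` C" for S
      using ind that by (auto simp: indep_vars_def)
    then show "(\<lambda>\<omega>. \<Prod>S\<in>B ` C. the_inv_into C B S ^ point_count X S \<omega>) \<in> borel_measurable M"
      by (intro borel_measurable_prod) (auto intro: measurable_compose)
  qed (rule borel_measurable_ppp_prod; fact)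
  also have "\<dots> = (\<Prod>S\<in>B ` C. expectation (\<lambda>\<omega>. the_inv_into C B S ^ point_count X S \<omega>))"
  proof (rule indep_vars_lebesgue_integral)
    show iv: "indep_vars (\<lambda>_. borel) (\<lambda>S \<omega>. the_inv_into C B S ^ point_count X S \<omega>) (B ` C)"
      by (rule indep_vars_compose2[OF ind]) simp
    show "integrable M (\<lambda>\<omega>. the_inv_into C B S ^ point_count X S \<omega>)" if S: "S \<in> B ` C" for S
    proof (rule integrable_const_bound[where B = 1])
      obtain c where "c \<in> C" "S = B c" using S by blast
      then have "the_inv_into C B S = c"
        by (simp only: the_inv_into_f_f[OF inj])
      moreover have "c \<in> f ` A"
        using \<open>c \<in> C\<close> by (simp add: C_def)
      ultimately show "AE \<omega> in M. norm (the_inv_into C B S ^ point_count X S \<omega>) \<le> 1"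
        using f01 by (auto simp: power_abs intro!: power_le_one)
      show "(\<lambda>\<omega>. the_inv_into C B S ^ point_count X S \<omega>) \<in> borel_measurable M"
        using iv S by (auto simp: indep_vars_def)
    qed
  qed (use fin in simp)
  also have "\<dots> = (\<Prod>c\<in>C. exp (- (lam * measure lborel (B c) * (1 - c))))"
    by (simp add: prod.reindex[OF inj] the_inv_into_f_f[OF inj] ppp_expectation_power[OF B Bb])
  also have "\<dots> = exp (- (lam * (\<Sum>c\<in>C. (1 - c) * measure lborel (B c))))"
    by (simp add: exp_sum[OF fin, symmetric] sum_distrib_left sum_negf mult_ac)
  also have "(\<Sum>c\<in>C. (1 - c) * measure lborel (B c)) =
      (\<integral>x. (\<Sum>c\<in>C. (1 - c) * indicator (B c) x) \<partial>lborel)"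
  proof (subst Bochner_Integration.integral_sum)
    show "integrable lborel (\<lambda>x. (1 - c) * indicator (B c) x :: real)" for c
      using emeasure_bounded_finite[OF Bb] by (intro integrable_mult_right) (simp add: integrable_indicator_iff)
  qed simp
  also have "\<dots> = (\<integral>x\<in>A. (1 - f x) \<partial>lborel)"
    unfolding set_lebesgue_integral_def
  proof (rule Bochner_Integration.integral_cong[OF refl])
    fix x
    have "(\<Sum>c\<in>C. (1 - c) * indicator (B c) x) = (\<Sum>c\<in>C. if c = f x then indicator A x * (1 - f x) else 0)"
      by (intro sum.cong) (auto simp: B_def indicator_def)
    then show "(\<Sum>c\<in>C. (1 - c) * indicator (B c) x) = indicator A x *\<^sub>R (1 - f x)"
      using fin by (auto simp: C_def B_def indicator_def)
  qed
  finally show ?thesis .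
qed

text \<open>Simple functions increasing to \<open>f\<close> stay in [0, 1], so the products are
  dominated by 1 and the integrands by the indicator of the bounded set \<open>A\<close>.\<close>

lemma ppp_expectation_prod:
  fixes f :: "'b \<Rightarrow> real"
  assumes [measurable]: "A \<in> sets borel" "f \<in> borel_measurable borel" and "bounded A"
    and f01: "\<And>x. 0 \<le> f x" "\<And>x. f x \<le> 1"
  shows "expectation (\<lambda>\<omega>. \<Prod>i\<in>{i. X i \<omega> \<in> A}. f (X i \<omega>)) =
    exp (- (lam * (\<integral>x\<in>A. (1 - f x) \<partial>lborel)))"
proof -
  obtain u where inc: "incseq u" and us: "\<And>n. simple_function borel (u n)"
    and bdd: "\<And>x. bdd_above (range (\<lambda>n. u n x))" and u0: "\<And>n x. 0 \<le> u n x"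
    and f_eq: "f = (SUP n. u n)"
    using borel_measurable_implies_simple_function_sequence_real[OF assms(2) f01(1)] by blast
  have fx: "f x = (SUP n. u n x)" for x
    by (simp add: f_eq Sup_apply image_image)
  have uf: "u n x \<le> f x" for n x
    unfolding fx by (rule cSUP_upper[OF UNIV_I bdd])
  have ulim: "(\<lambda>n. u n x) \<longlonglongrightarrow> f x" for x
    unfolding fx using inc by (intro LIMSEQ_incseq_SUP bdd) (auto simp: incseq_def le_fun_def)
  have u1: "u n x \<le> 1" for n x using uf f01(2) order_trans by blast
  have um[measurable]: "u n \<in> borel_measurable borel" for n
    using us by (rule borel_measurable_simple_function)
  have "(\<lambda>n. expectation (\<lambda>\<omega>. \<Prod>i\<in>{i. X i \<omega> \<in> A}. u n (X i \<omega>))) \<longlonglongrightarrow>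
      expectation (\<lambda>\<omega>. \<Prod>i\<in>{i. X i \<omega> \<in> A}. f (X i \<omega>))"
    by (rule integral_dominated_convergence[where w = "\<lambda>_. 1"])
      (auto intro!: borel_measurable_ppp_prod um assms(1,2) tendsto_prod ulim AE_I2 simp: abs_prod u0 intro: prod_le_1 u1)
  moreover have "(\<lambda>n. \<integral>x\<in>A. (1 - u n x) \<partial>lborel) \<longlonglongrightarrow> (\<integral>x\<in>A. (1 - f x) \<partial>lborel)"
    unfolding set_lebesgue_integral_def
  proof (rule integral_dominated_convergence[where w = "indicator A"])
    show "integrable lborel (indicator A :: 'b \<Rightarrow> real)"
      using emeasure_bounded_finite[OF \<open>bounded A\<close>] by (simp add: integrable_indicator_iff)
    show "AE x in lborel. norm (indicator A x *\<^sub>R (1 - u n x)) \<le> indicator A x" for n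
      using u0[of n] u1[of n] by (intro AE_I2) (auto simp: indicator_def)
    show "AE x in lborel. (\<lambda>n. indicator A x *\<^sub>R (1 - u n x)) \<longlonglongrightarrow> indicator A x *\<^sub>R (1 - f x)"
      by (auto intro!: tendsto_intros ulim)
  qed measurable
  then have "(\<lambda>n. expectation (\<lambda>\<omega>. \<Prod>i\<in>{i. X i \<omega> \<in> A}. u n (X i \<omega>))) \<longlonglongrightarrow>
      exp (- (lam * (\<integral>x\<in>A. (1 - f x) \<partial>lborel)))"
    using us u0 u1 \<open>bounded A\<close>
    by (subst ppp_expectation_prod_simple) (auto intro!: tendsto_intros)
  ultimately show ?thesis
    by (rule LIMSEQ_unique)
qed

end
end

subsection \<open>The maximal SINR\<close>

text \<open>
  On infinite sets \<^const>\<open>Max\<close> is a fixed junk value, so no finiteness assumption is needed.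
\<close>

lemma borel_measurable_Max_nat:
  fixes v :: "nat \<Rightarrow> 'a \<Rightarrow> real"
  assumes [measurable]: "\<And>i. v i \<in> borel_measurable M" "\<And>i. Measurable.pred M (S i)"
  shows "(\<lambda>\<omega>. Max ((\<lambda>i. v i \<omega>) ` {i. S i \<omega>})) \<in> borel_measurable M"
proof (subst borel_measurable_iff_le, safe)
  fix a :: real
  \<comment> \<open>The set of values is finite iff all of them occur at indices below some bound,
    which is a countable condition.\<close>
  have fin: "finite ((\<lambda>i. v i \<omega>) ` {i. S i \<omega>}) \<longleftrightarrow> (\<exists>n. \<forall>i. S i \<omega> \<longrightarrow> (\<exists>j<n. S j \<omega> \<and> v i \<omega> = v j \<omega>))"
    (is "finite ?V \<longleftrightarrow> ?R") for \<omega>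
  proof
    assume "finite ?V"
    then obtain C where C: "C \<subseteq> {i. S i \<omega>}" "finite C" "?V = (\<lambda>i. v i \<omega>) ` C"
      using finite_subset_image[of ?V "\<lambda>i. v i \<omega>" "{i. S i \<omega>}"] by auto
    obtain n where n: "\<forall>j\<in>C. j < n"
      using \<open>finite C\<close> by (auto simp: finite_nat_set_iff_bounded)
    have "\<exists>j<n. S j \<omega> \<and> v i \<omega> = v j \<omega>" if "S i \<omega>" for i
    proof -
      have "v i \<omega> \<in> (\<lambda>i. v i \<omega>) ` C" using that C(3) by blast
      then show ?thesis using C(1) n by blast
    qed
    then show ?R by blast
  next
    assume ?R
    then obtain n where "?V \<subseteq> (\<lambda>i. v i \<omega>) ` {..<n}" by blast
    then show "finite ?V" by (rule finite_subset) simp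
  qed
  \<comment> \<open>Empty, finite and infinite value sets; in the first and last case
    \<open>Max\<close> is a constant.\<close>
  have "Max ((\<lambda>i. v i \<omega>) ` {i. S i \<omega>}) \<le> a \<longleftrightarrow>
      (if \<forall>i. \<not> S i \<omega> then Max {} \<le> a
       else if \<exists>n. \<forall>i. S i \<omega> \<longrightarrow> (\<exists>j<n. S j \<omega> \<and> v i \<omega> = v j \<omega>) then \<forall>i. S i \<omega> \<longrightarrow> v i \<omega> \<le> a
       else the None \<le> a)" for \<omega>
    unfolding fin[symmetric] by (auto simp: Max.infinite)
  then show "{\<omega> \<in> space M. Max ((\<lambda>i. v i \<omega>) ` {i. S i \<omega>}) \<le> a} \<in> sets M"
    by (simp only:) measurable
qed

section \<open>Distribution of the maximal SINR in the network\<close>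

context beamforming_network
begin

lemma loc_measurable [measurable]: "random_variable borel (loc i)"
  using locations_ppp by (simp add: homogeneous_ppp_def)

lemma fading_measurable [measurable]: "random_variable borel (h i)"
proof -
  have "(\<lambda>\<omega> i. h i \<omega>) \<in> measurable P (Pi\<^sub>M UNIV (\<lambda>_. borel))"
    using fading_locations_indep by (simp add: indep_rv_def)
  from measurable_compose[OF this measurable_component_singleton[of i]] show ?thesis by simp
qed

lemma beam_measurable [measurable]: "random_variable borel (b k)"
proof -
  have "(\<lambda>\<omega> k. b k \<omega>) \<in> measurable P (Pi\<^sub>M UNIV (\<lambda>_. borel))"
    using beams_indep by (simp add: indep_rv_def)
  from measurable_compose[OF this measurable_component_singleton[of k]] show ?thesis by simp
qed

lemma fading_indep': "indep_vars (\<lambda>_. borel) (\<lambda>p \<omega>. h (fst p) \<omega> $ snd p) UNIV"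
proof -
  have "(\<lambda>p \<omega>. h (fst p) \<omega> $ snd p) = (\<lambda>(i, j) \<omega>. h i \<omega> $ j)"
    by (simp add: fun_eq_iff)
  then show ?thesis using fading_indep by simp
qed

lemma fading_components_indep: "indep_vars (\<lambda>_. borel) (\<lambda>j \<omega>. h i \<omega> $ j) UNIV"
proof -
  have "indep_vars (\<lambda>_. borel) (\<lambda>p \<omega>. h (fst p) \<omega> $ snd p) (range (Pair i))"
    using indep_vars_subset[OF fading_indep', of "range (Pair i)"] by simp
  from indep_vars_reindex[OF _ this] show ?thesis
    by (simp add: comp_def inj_on_def)
qed

text \<open>Different users occupy disjoint blocks of the index set of pairs, and each vector is a
  function of its own block.\<close>

lemma fading_vectors_indep: "indep_vars (\<lambda>_. borel) h UNIV"
proof -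
  let ?K = "\<lambda>i::nat. {i} \<times> (UNIV :: 'm set)"
  have *: "indep_vars (\<lambda>i. PiM (?K i) (\<lambda>_. borel)) (\<lambda>i \<omega>. restrict (\<lambda>p. h (fst p) \<omega> $ snd p) (?K i)) UNIV"
    by (rule indep_vars_restrict[OF fading_indep']) (auto simp: disjoint_family_on_def)
  have "(\<lambda>f. \<chi> j. f (i, j)) \<in> borel_measurable (PiM (?K i) (\<lambda>_. borel :: complex measure))" for i
    by (rule measurable_compose[OF _ borel_measurable_vec_lambda]) (intro measurable_PiM_single'; simp add: space_PiM)
  from indep_vars_compose2[OF * this] show ?thesis
    by simp
qed

context
  fixes D \<rho> y :: real and G :: "real \<Rightarrow> real" and m :: 'm
  assumes \<rho>: "\<rho> > 0" and lam: "lam > 0" and D: "D > 0"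
    and cont: "continuous_on {0<..} G" and pos: "\<forall>d>0. G d > 0"
begin

lemma G_pos: "d > 0 \<Longrightarrow> G d > 0"
  using pos by blast

lemma borel_measurable_G: "(\<lambda>d. indicator {0<..} d * G d) \<in> borel_measurable borel"
  using borel_measurable_continuous_on_indicator[OF _ cont] by simp

text \<open>Continuity covers positive distances only; the arbitrary value at the origin is split
  off as a single point.\<close>

lemma borel_measurable_G_norm [measurable]: "(\<lambda>x::real ^ 2. G (norm x)) \<in> borel_measurable borel"
proof -
  have [measurable]: "(\<lambda>x::real ^ 2. indicator {0<..} (norm x) * G (norm x)) \<in> borel_measurable borel"
    by (rule measurable_compose[OF _ borel_measurable_G]) simp
  have "(\<lambda>x::real ^ 2. if x = 0 then G 0 else indicator {0<..} (norm x) * G (norm x)) \<in> borel_measurable borel"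
    by measurable
  also have "(\<lambda>x::real ^ 2. if x = 0 then G 0 else indicator {0<..} (norm x) * G (norm x)) = (\<lambda>x. G (norm x))"
    by auto
  finally show ?thesis .
qed

lemma AE_no_user_at_origin: "AE \<omega> in P. \<forall>i. loc i \<omega> \<noteq> 0"
  using ppp_AE_avoids_point[OF _ locations_ppp] lam by simp

lemma AE_finite_cell: "AE \<omega> in P. finite {i. loc i \<omega> \<in> cball 0 D}"
  by (rule ppp_AE_finite[OF _ locations_ppp]) (use lam in auto)

lemma cell_sets [measurable]: "(cball 0 D :: (real ^ 2) set) \<in> sets borel"
  by simp

lemma user_sinr_measurable [measurable]: "random_variable borel (user_sinr \<rho> G loc h b m i)"
  unfolding user_sinr_def dist_0_norm by measurable

lemma max_sinr_measurable [measurable]: "random_variable borel (max_sinr D \<rho> G loc h b m)"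
proof -
  have "random_variable borel (\<lambda>\<omega>. Max ((\<lambda>i. user_sinr \<rho> G loc h b m i \<omega>) ` {i. loc i \<omega> \<in> cball 0 D}))"
    by (rule borel_measurable_Max_nat[of "user_sinr \<rho> G loc h b m" P "\<lambda>i \<omega>. loc i \<omega> \<in> cball 0 D"]) measurable
  moreover have "Measurable.pred P (\<lambda>\<omega>. cell_users D loc \<omega> = {})"
    unfolding cell_users_def Collect_empty_eq by measurable
  ultimately show ?thesis
    unfolding max_sinr_def[abs_def] cell_users_def by (intro measurable_If) (auto simp: pred_def)
qed

text \<open>Off a null event the cell is finite and no user sits at the origin, so the maximum is
  genuine and all SINRs are nonnegative. For an empty cell the convention 0 agrees with the vacuous
  condition because \<open>y\<close> is nonnegative.\<close>

lemma AE_max_sinr_le_iff: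
  "AE \<omega> in P. max_sinr D \<rho> G loc h b m \<omega> \<ge> 0 \<and>
    (\<forall>y\<ge>0. max_sinr D \<rho> G loc h b m \<omega> \<le> y \<longleftrightarrow>
      (\<forall>i. loc i \<omega> \<in> cball 0 D \<longrightarrow> user_sinr \<rho> G loc h b m i \<omega> \<le> y))"
proof -
  have "AE \<omega> in P. finite {i. loc i \<omega> \<in> cball 0 D}"
    by (rule AE_finite_cell)
  with AE_no_user_at_origin show ?thesis
  proof eventually_elim
    case (elim \<omega>)
    let ?C = "{i. loc i \<omega> \<in> cball 0 D}"
    let ?v = "\<lambda>i. user_sinr \<rho> G loc h b m i \<omega>"
    have nn: "?v i \<ge> 0" for i
      using elim G_pos \<rho> by (auto simp: user_sinr_def intro!: sinr_nonneg)
    show ?case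
    proof (cases "?C = {}")
      case True
      then show ?thesis by (auto simp: max_sinr_def cell_users_def)
    next
      case False
      then have "max_sinr D \<rho> G loc h b m \<omega> = Max (?v ` ?C)"
        by (simp only: max_sinr_def cell_users_def if_False)
      moreover have "finite (?v ` ?C)" "?v ` ?C \<noteq> {}" using elim False by auto
      ultimately show ?thesis
        using nn by (auto simp: Max_ge_iff)
    qed
  qed
qed

lemma prob_max_sinr_le:
  assumes y: "y \<ge> 0"
  shows "\<P>(\<omega> in P. max_sinr D \<rho> G loc h b m \<omega> \<le> y) =
    exp (- lam * pi / (y + 1) ^ (CARD('m) - 1) * integral {0..D\<^sup>2} (\<lambda>t. exp (- y / (G (sqrt t) * \<rho>))))"
proof -
  define K where "K = (1 + y) ^ (CARD('m) - 1)"
  have K: "K \<ge> 1" using y by (simp add: K_def)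
  \<comment> \<open>Beams, fading and locations are plain arguments so that each can be frozen
    separately.\<close>
  define Q where "Q = (\<lambda>\<beta> (z :: nat \<Rightarrow> complex ^ 'm) (l :: nat \<Rightarrow> real ^ 2).
    \<forall>i. l i \<in> cball 0 D \<longrightarrow> sinr \<rho> (G (norm (l i))) (z i) \<beta> m \<le> y)"
  \<comment> \<open>The single-user probability as a function of position. The value 1 at the origin
    keeps \<open>f\<close> in [0, 1] whatever \<open>G 0\<close> is.\<close>
  define f where "f = (\<lambda>x::real ^ 2. if x = 0 then 1 else 1 - exp (- y / (G (norm x) * \<rho>)) / K)"
  have f[measurable]: "f \<in> borel_measurable borel" unfolding f_def by measurable
  have f01: "0 \<le> f x" "f x \<le> 1" for x
  proof -
    have "exp (- y / (G (norm x) * \<rho>)) / K \<le> 1" if "x \<noteq> 0"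
      using that y K G_pos[of "norm x"] \<rho> by (simp add: divide_le_eq order_trans[of _ 1])
    then show "0 \<le> f x" "f x \<le> 1" using K by (auto simp: f_def)
  qed
  have cell_prob: "\<P>(\<omega> in P. Q \<beta> (\<lambda>i. h i \<omega>) l) = (\<Prod>i\<in>{i. l i \<in> cball 0 D}. f (l i))"
    if \<beta>: "orthonormal_beams \<beta>" and fin: "finite {i. l i \<in> cball 0 D}" and l0: "\<And>i. l i \<noteq> 0" for \<beta> l
  \<comment> \<open>The product rule for independent events needs a nonempty index set; for an empty
    cell both sides are 1.\<close>
  proof (cases "{i. l i \<in> cball 0 D} = {}")
    case True
    then show ?thesis by (simp add: Q_def prob_space)
  next
    case False
    let ?C = "{i. l i \<in> cball 0 D}" and ?X = "\<lambda>i \<omega>. sinr \<rho> (G (norm (l i))) (h i \<omega>) \<beta> m"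
    have ind: "indep_vars (\<lambda>_. borel) ?X UNIV"
      by (rule indep_vars_compose2[OF fading_vectors_indep]) measurable
    have single: "prob (?X i -` {..y} \<inter> space P) = f (l i)" for i
    proof -
      have "?X i -` {..y} \<inter> space P = {\<omega> \<in> space P. ?X i \<omega> \<le> y}" by auto
      then show ?thesis
        using prob_sinr_le[OF fading_components_indep fading_law \<beta> G_pos \<rho> y, of "norm (l i)" i m] l0[of i]
        by (simp add: f_def K_def)
    qed
    have "{\<omega> \<in> space P. Q \<beta> (\<lambda>i. h i \<omega>) l} = (\<Inter>i\<in>?C. ?X i -` {..y} \<inter> space P)"
      using False by (auto simp: Q_def)
    also have "prob \<dots> = (\<Prod>i\<in>?C. prob (?X i -` {..y} \<inter> space P))"
      using False fin by (intro indep_varsD[OF ind]) auto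
    finally show ?thesis
      by (simp only: single)
  qed
  \<comment> \<open>The space \<open>N\<close> is arbitrary because both the product spaces of
    sequences and \<open>P\<close> itself are needed.\<close>
  have Q_meas: "Measurable.pred N (\<lambda>\<omega>. Q (\<lambda>k. \<beta> k \<omega>) (\<lambda>i. z i \<omega>) (\<lambda>i. l i \<omega>))"
    if [measurable]: "\<And>k. \<beta> k \<in> borel_measurable N" "\<And>i. z i \<in> borel_measurable N" "\<And>i. l i \<in> borel_measurable N"
    for N :: "'x measure" and \<beta> z l
  proof -
    have [measurable]: "(\<lambda>\<omega>. G (norm (l i \<omega>))) \<in> borel_measurable N" for i
      by (rule measurable_compose[OF _ borel_measurable_G_norm]) measurable
    have [measurable]: "(\<lambda>\<omega>. sinr \<rho> (G (norm (l i \<omega>))) (z i \<omega>) (\<lambda>k. \<beta> k \<omega>) m) \<in> borel_measurable N" for i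
      by (rule borel_measurable_sinr) measurable
    show ?thesis
      unfolding Q_def by measurable
  qed
  have fixed_beams: "\<P>(\<omega> in P. Q \<beta> (\<lambda>i. h i \<omega>) (\<lambda>i. loc i \<omega>)) =
      exp (- (lam * (\<integral>x\<in>cball 0 D. (1 - f x) \<partial>lborel)))" if \<beta>: "orthonormal_beams \<beta>" for \<beta>
  proof -
    have rv: "random_variable (PiM UNIV (\<lambda>_. borel)) (\<lambda>\<omega> i. h i \<omega>)"
      "random_variable (PiM UNIV (\<lambda>_. borel)) (\<lambda>\<omega> i. loc i \<omega>)"
      using fading_locations_indep by (auto simp: indep_rv_def)
    note joint = joint_distr_swap[OF rv indep_rv_distr[OF fading_locations_indep]]
    have Q: "Measurable.pred (PiM UNIV (\<lambda>_. borel) \<Otimes>\<^sub>M PiM UNIV (\<lambda>_. borel)) (\<lambda>(l, z). Q \<beta> z l)"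
      using Q_meas[of "\<lambda>k _. \<beta> k" "PiM UNIV (\<lambda>_. borel) \<Otimes>\<^sub>M PiM UNIV (\<lambda>_. borel)" "\<lambda>i p. snd p i" "\<lambda>i p. fst p i"]
      by (simp add: case_prod_beta)
    note cond = prob_joint_eq_expectation[OF rv(2,1) joint Q]
    have "\<P>(\<omega> in P. Q \<beta> (\<lambda>i. h i \<omega>) (\<lambda>i. loc i \<omega>)) =
        expectation (\<lambda>\<omega>'. \<P>(\<omega> in P. Q \<beta> (\<lambda>i. h i \<omega>) (\<lambda>i. loc i \<omega>')))"
      by (rule cond(2))
    also have "\<dots> = expectation (\<lambda>\<omega>. \<Prod>i\<in>{i. loc i \<omega> \<in> cball 0 D}. f (loc i \<omega>))"
    proof (rule integral_cong_AE[OF cond(1)])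
      show "(\<lambda>\<omega>. \<Prod>i\<in>{i. loc i \<omega> \<in> cball 0 D}. f (loc i \<omega>)) \<in> borel_measurable P"
        using lam by (intro borel_measurable_ppp_prod[OF _ locations_ppp]) auto
      have "AE \<omega> in P. finite {i. loc i \<omega> \<in> cball 0 D}"
        by (rule AE_finite_cell)
      with AE_no_user_at_origin
      show "AE \<omega>' in P. \<P>(\<omega> in P. Q \<beta> (\<lambda>i. h i \<omega>) (\<lambda>i. loc i \<omega>')) =
          (\<Prod>i\<in>{i. loc i \<omega>' \<in> cball 0 D}. f (loc i \<omega>'))"
        by eventually_elim (use cell_prob[OF \<beta>] in auto)
    qed
    also have "\<dots> = exp (- (lam * (\<integral>x\<in>cball 0 D. (1 - f x) \<partial>lborel)))"
      using lam f01 by (intro ppp_expectation_prod[OF _ locations_ppp]) auto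
    finally show ?thesis .
  qed
  have "\<P>(\<omega> in P. max_sinr D \<rho> G loc h b m \<omega> \<le> y) = \<P>(\<omega> in P. Q (\<lambda>k. b k \<omega>) (\<lambda>i. h i \<omega>) (\<lambda>i. loc i \<omega>))"
  proof (rule finite_measure_eq_AE)
    show "AE \<omega> in P. \<omega> \<in> {\<omega> \<in> space P. max_sinr D \<rho> G loc h b m \<omega> \<le> y} \<longleftrightarrow>
        \<omega> \<in> {\<omega> \<in> space P. Q (\<lambda>k. b k \<omega>) (\<lambda>i. h i \<omega>) (\<lambda>i. loc i \<omega>)}"
      using AE_max_sinr_le_iff by eventually_elim (use y in \<open>simp add: Q_def user_sinr_def\<close>)
    show "{\<omega> \<in> space P. Q (\<lambda>k. b k \<omega>) (\<lambda>i. h i \<omega>) (\<lambda>i. loc i \<omega>)} \<in> events"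
      using Q_meas[of b P h loc] by (simp add: pred_def)
  qed measurable
  also have "\<dots> = expectation (\<lambda>\<omega>'. \<P>(\<omega> in P. Q (\<lambda>k. b k \<omega>') (\<lambda>i. h i \<omega>) (\<lambda>i. loc i \<omega>)))"
  proof -
    have rv: "random_variable (PiM UNIV (\<lambda>_. borel)) (\<lambda>\<omega> k. b k \<omega>)"
      "random_variable (PiM UNIV (\<lambda>_. borel) \<Otimes>\<^sub>M PiM UNIV (\<lambda>_. borel)) (\<lambda>\<omega>. (\<lambda>i. h i \<omega>, \<lambda>i. loc i \<omega>))"
      using beams_indep by (auto simp: indep_rv_def)
    have "Measurable.pred (PiM UNIV (\<lambda>_. borel) \<Otimes>\<^sub>M (PiM UNIV (\<lambda>_. borel) \<Otimes>\<^sub>M PiM UNIV (\<lambda>_. borel)))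
        (\<lambda>(\<beta>, zl). Q \<beta> (fst zl) (snd zl))"
      using Q_meas[of "\<lambda>k p. fst p k" "PiM UNIV (\<lambda>_. borel) \<Otimes>\<^sub>M (PiM UNIV (\<lambda>_. borel) \<Otimes>\<^sub>M PiM UNIV (\<lambda>_. borel))"
          "\<lambda>i p. fst (snd p) i" "\<lambda>i p. snd (snd p) i"]
      by (simp add: case_prod_beta)
    from prob_joint_eq_expectation(2)[OF rv indep_rv_distr[OF beams_indep] this]
    show ?thesis by simp
  qed
  \<comment> \<open>The conditional probability is constant in the beams.\<close>
  also have "\<dots> = expectation (\<lambda>_. exp (- (lam * (\<integral>x\<in>cball 0 D. (1 - f x) \<partial>lborel))))"
    by (intro Bochner_Integration.integral_cong refl fixed_beams beams_orthonormal)
  also have "\<dots> = exp (- (lam * (\<integral>x\<in>cball 0 D. (1 - f x) \<partial>lborel)))"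
    by (simp add: prob_space)
  also have "(\<integral>x\<in>cball 0 D. (1 - f x) \<partial>lborel) =
      pi / K * integral {0..D\<^sup>2} (\<lambda>t. exp (- y / (G (sqrt t) * \<rho>)))"
  proof -
    define u where "u = (\<lambda>t. exp (- y / (G (sqrt t) * \<rho>)))"
    \<comment> \<open>Radial profile of \<open>1 - f\<close> up to the factor 1 / \<open>K\<close>,
      in the variable t = d^2. Leaving out t = 0 matches \<open>f 0 = 1\<close>.\<close>
    define v where "v = (\<lambda>t. indicator {0<..D\<^sup>2} t * u t)"
    have v[measurable]: "v \<in> borel_measurable borel"
    proof -
      have [measurable]: "(\<lambda>t. indicator {0<..} (sqrt t) * G (sqrt t)) \<in> borel_measurable borel"
        by (rule measurable_compose[OF _ borel_measurable_G]) simp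
      have "(\<lambda>t. indicator {0<..D\<^sup>2} t * exp (- y / (indicator {0<..} (sqrt t) * G (sqrt t) * \<rho>))) \<in> borel_measurable borel"
        by measurable
      also have "(\<lambda>t. indicator {0<..D\<^sup>2} t * exp (- y / (indicator {0<..} (sqrt t) * G (sqrt t) * \<rho>))) = v"
        by (auto simp: v_def u_def indicator_def)
      finally show ?thesis .
    qed
    have "(\<integral>x\<in>cball 0 D. (1 - f x) \<partial>lborel) = (\<integral>x. v ((norm x)\<^sup>2) / K \<partial>(lborel :: (real ^ 2) measure))"
      unfolding set_lebesgue_integral_def
    proof (rule Bochner_Integration.integral_cong[OF refl])
      fix x :: "real ^ 2"
      have "(norm x)\<^sup>2 \<le> D\<^sup>2 \<longleftrightarrow> norm x \<le> D"
        using D by (simp add: power2_le_iff_abs_le)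
      then show "indicator (cball 0 D) x *\<^sub>R (1 - f x) = v ((norm x)\<^sup>2) / K"
        by (simp add: f_def v_def u_def indicator_def)
    qed
    also have "\<dots> = pi * (\<integral>t. indicator {0..} t * v t \<partial>lborel) / K"
      by (simp add: integral_norm_square)
    also have "(\<lambda>t. indicator {0..} t * v t) = v"
      by (auto simp: v_def indicator_def)
    also have "(\<integral>t. v t \<partial>lborel) = integral {0..D\<^sup>2} u"
      unfolding v_def
    proof (rule lebesgue_integral_eq_integral_Icc)
      show "\<bar>u t\<bar> \<le> 1" if "0 < t" for t
        using that y \<rho> G_pos[of "sqrt t"] by (simp add: u_def)
    qed (use v in \<open>simp add: v_def\<close>)
    finally show ?thesis
      by (simp add: u_def)
  qed
  finally show ?thesis
    by (simp add: K_def add.commute)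
qed

end
end

theorem theorem1:
  fixes P :: "'w measure"
    and D lam \<rho> \<alpha> x :: real
    and G :: "real \<Rightarrow> real"
    and loc :: "nat \<Rightarrow> 'w \<Rightarrow> real ^ 2"
    and h :: "nat \<Rightarrow> 'w \<Rightarrow> complex ^ 'm::finite"
    and b :: "'m \<Rightarrow> 'w \<Rightarrow> complex ^ 'm"
    and m :: 'm
  assumes "beamforming_network P lam loc h b"
    and "D > 0" and "lam > 0" and "\<rho> > 0"
    and "continuous_on {0<..} G"
    and "\<And>d. d > 0 \<Longrightarrow> G d > 0"
    and "antimono_on {0<..} G"
    and "\<alpha> > 2" and "G \<in> O(\<lambda>d. d powr (- \<alpha>))"
    and "x \<ge> 0"
  shows "beam_outage_prob P D \<rho> G loc h b m x = max_sinr_cdf P D \<rho> G loc h b m (exp x - 1) \<and>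
    (\<forall>y\<ge>0. max_sinr_cdf P D \<rho> G loc h b m y =
      exp (- lam * pi / (y + 1) ^ (CARD('m) - 1) *
           integral {0..D\<^sup>2} (\<lambda>t. exp (- y / (G (sqrt t) * \<rho>)))))"
proof -
  interpret beamforming_network P lam loc h b by fact
  have "\<forall>d>0. G d > 0"
    using assms(6) by blast
  note G = assms(4,3,2,5) this
  have [measurable]: "random_variable borel (max_sinr D \<rho> G loc h b m)"
    by (rule max_sinr_measurable[OF G])
  have cdf: "max_sinr_cdf P D \<rho> G loc h b m y = \<P>(\<omega> in P. max_sinr D \<rho> G loc h b m \<omega> \<le> y)" for y
    by (simp add: max_sinr_cdf_def cdf_def measure_distr vimage_def Int_def conj_commute)
  have "beam_outage_prob P D \<rho> G loc h b m x = \<P>(\<omega> in P. max_sinr D \<rho> G loc h b m \<omega> \<le> exp x - 1)"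
    unfolding beam_outage_prob_def
  proof (rule finite_measure_eq_AE)
    show "AE \<omega> in P. \<omega> \<in> {\<omega> \<in> space P. beam_rate D \<rho> G loc h b m \<omega> \<le> x} \<longleftrightarrow>
        \<omega> \<in> {\<omega> \<in> space P. max_sinr D \<rho> G loc h b m \<omega> \<le> exp x - 1}"
      using AE_max_sinr_le_iff[OF G, of m]
    proof eventually_elim
      case (elim \<omega>)
      \<comment> \<open>Nonnegativity of the maximum makes the argument of \<open>ln\<close>
        positive, so \<open>exp\<close> inverts it.\<close>
      then have "ln (1 + max_sinr D \<rho> G loc h b m \<omega>) \<le> x \<longleftrightarrow> 1 + max_sinr D \<rho> G loc h b m \<omega> \<le> exp x"
        by (subst exp_le_cancel_iff[symmetric]) simp
      then show ?case by (auto simp: beam_rate_def)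
    qed
  qed (unfold beam_rate_def, measurable)
  then show ?thesis
    by (simp add: cdf prob_max_sinr_le[OF G])
qed

end
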